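(* Let $G\neq\delta_0$ be a probability measure on $[0,\infty)$ and let $t_0:=\inf\{x: G([0,x])>0\}$. Then the point $(0,1)$ lies on a flat edge of the limit shape $\mathcal B_G$ if and only if $G(\{t_0\})>0$.
   Context: Model: Let $G$ be a probability measure on $[0,\infty)$. In the nearest-neighbour lattice $\mathbb Z^2$, every vertical edge (joining $(x,y)$ and $(x,y+1)$) receives the deterministic weight $\tau_e=1$, and every horizontal edge (joining $(x,y)$ and $(x+1,y)$) receives a random weight $\tau_e$, the horizontal weights being independent with law $G$. A path is a sequence $p=(z_0,z_1,\dots)$ of points of $\mathbb Z^2$ with $z_k,z_{k+1}$ joined by an edge; an edge $e$ lies in $p$ if $e=(z_k,z_{k+1})$ for some $k$. The passage time is $T(p)=\sum_{e\in p}\tau_e$, and for $u,w\in\mathbb Z^2$, $T(u,w)=\inf_p T(p)$ over paths from $u$ to $w$. For $v\ge0$, the time constant $\Lambda(v)=\lim_{n\to\infty}\frac1n T((0,0),(n,\lceil vn\rceil))$ exists almost surely, is deterministic, convex, and $\Lambda(v)>0$ for all $v\ge 0$ when $G\neq\delta_0$. Limit shape: for $0\le\theta<\pi/2$ set $\mathcal B(\theta)=\frac{1}{\Lambda(\tan\theta)\cos\theta}$, extended continuously to $\theta=\pi/2$ (where the value is $1$). The limit shape $\mathcal B_G$ is the closed region bounded by the four symmetric curves $\mathcal B(\theta)e^{i\theta}$, $\mathcal B(\theta)e^{-i\theta}$, $-\mathcal B(\theta)e^{i\theta}$, $-\mathcal B(\theta)e^{-i\theta}$ ($0\le\theta\le\pi/2$,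 identifying $\mathbb R^2$ with $\mathbb C$), whose union is the boundary $\partial\mathcal B_G$. A point $x\in\partial\mathcal B_G$ lies on a flat edge if there is $y\in\partial\mathcal B_G\setminus\{x\}$ such that the segment from $x$ to $y$ is contained in $\partial\mathcal B_G$. *)

theory Defs
  imports "HOL-Probability.Probability"
begin

text \<open>Lattice points of Z^2 are pairs of integers. The horizontal edge joining (x,y) and (x+1,y)
  carries the weight omega (x,y); vertical edges carry weight 1. Edges are unordered
  (two-element sets of lattice points).\<close>

definition lattice_adj :: "int \<times> int \<Rightarrow> int \<times> int \<Rightarrow> bool" where
  "lattice_adj a b \<longleftrightarrow> \<bar>fst a - fst b\<bar> + \<bar>snd a - snd b\<bar> = 1"

definition lattice_path :: "(int \<times> int) list \<Rightarrow> int \<times> int \<Rightarrow> int \<times> int \<Rightarrow> bool" where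
  "lattice_path p u w \<longleftrightarrow> p \<noteq> [] \<and> hd p = u \<and> last p = w \<and>
     (\<forall>k. Suc k < length p \<longrightarrow> lattice_adj (p ! k) (p ! Suc k))"

definition path_edges :: "(int \<times> int) list \<Rightarrow> (int \<times> int) set set" where
  "path_edges p = {{p ! k, p ! Suc k} | k. Suc k < length p}"

definition edge_weight :: "(int \<times> int \<Rightarrow> real) \<Rightarrow> (int \<times> int) set \<Rightarrow> real" where
  "edge_weight \<omega> e =
     (if \<exists>z. e = {z, (fst z + 1, snd z)} then \<omega> (THE z. e = {z, (fst z + 1, snd z)}) else 1)"

definition path_time :: "(int \<times> int \<Rightarrow> real) \<Rightarrow> (int \<times> int) list \<Rightarrow> real" where
  "path_time \<omega> p = (\<Sum>e\<in>path_edges p. edge_weight \<omega> e)"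

definition passage_time :: "(int \<times> int \<Rightarrow> real) \<Rightarrow> int \<times> int \<Rightarrow> int \<times> int \<Rightarrow> real" where
  "passage_time \<omega> u w = Inf {path_time \<omega> p | p. lattice_path p u w}"

text \<open>Environment: i.i.d. horizontal weights with law G (indexed by the left endpoint).\<close>
definition env :: "real measure \<Rightarrow> (int \<times> int \<Rightarrow> real) measure" where
  "env G = PiM UNIV (\<lambda>_. G)"

definition time_const :: "real measure \<Rightarrow> real \<Rightarrow> real" where
  "time_const G v = (THE c. AE \<omega> in env G.
      (\<lambda>n::nat. passage_time \<omega> (0,0) (int n, \<lceil>v * real n\<rceil>) / real n) \<longlonglongrightarrow> c)"

definition shape_radius :: "real measure \<Rightarrow> real \<Rightarrow> real" where
  "shape_radius G \<theta> = (if \<theta> = pi/2 then 1 else 1 / (time_const G (tan \<theta>) * cos \<theta>))"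

definition shape_boundary :: "real measure \<Rightarrow> complex set" where
  "shape_boundary G = {z. \<exists>\<theta>\<in>{0..pi/2}. let r = shape_radius G \<theta> in
      z = r * cis \<theta> \<or> z = r * cis (-\<theta>) \<or> z = - (r * cis \<theta>) \<or> z = - (r * cis (-\<theta>))}"

definition on_flat_edge :: "real measure \<Rightarrow> complex \<Rightarrow> bool" where
  "on_flat_edge G x \<longleftrightarrow> x \<in> shape_boundary G \<and>
     (\<exists>y\<in>shape_boundary G - {x}. closed_segment x y \<subseteq> shape_boundary G)"

end

theory Submission
  imports Defs "HOL-Library.Discrete_Functions" "HOL-Library.Nat_Bijection"
begin

text \<open>
  Vertical edges all cost 1, so a path gains nothing by moving left, and the passage time is a
  minimum over directed paths; in particular it is a function of independent columns.
  Resampling one column raises the minimum by at most the cost of a nearby cheap edge, which has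
  bounded second moment, so the Efron--Stein inequality bounds the variance of
  \<open>T((0,0),(n,\<lceil>vn\<rceil>))\<close> by \<open>C n\<close>. Chebyshev and Borel--Cantelli along \<open>n = k\<^sup>2\<close>, monotonicity
  in \<open>n\<close> and subadditivity of the means yield the almost sure limit \<open>\<Lambda>(v)\<close>.

  The point \<open>(0,1)\<close> lies on a flat edge iff \<open>\<Lambda>(v) - v\<close> is constant for large \<open>v\<close>. This function is
  nonincreasing with limit \<open>t\<^sub>0\<close>. If \<open>t\<^sub>0\<close> is an atom of \<open>G\<close>, a path that climbs in every column to
  the next edge of weight \<open>t\<^sub>0\<close> shows that the limit is attained. If not, then
  \<open>E exp(-\<kappa>(\<tau> - t\<^sub>0)) \<rightarrow> 0\<close> as \<open>\<kappa> \<rightarrow> \<infinity>\<close>, which beats the exponential number of directed paths, so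
  that \<open>\<Lambda>(v) > v + t\<^sub>0\<close> for every \<open>v\<close>.
\<close>

section \<open>Directed passage times\<close>

text \<open>No moment of \<open>G\<close> is assumed, so a single weight may have infinite mean. The
  substitute is the infinite height of a column: some bounded set of weights has positive mass, an
  edge with such a weight is met after a geometric number of vertical steps, and going there and
  back costs 2 per step. This is why whole columns, not single edges, are resampled.

  The quantity \<open>\<Lambda>(v) - v\<close> appears for a projective reason. The boundary point
  on the ray of slope \<open>v\<close> is \<open>(1, v) / \<Lambda>(v)\<close>, and substituting it
  into a line \<open>Im = 1 - c * Re\<close> through \<open>(0, 1)\<close> turns the line into
  \<open>\<Lambda>(v) = v + c\<close>. Approaching \<open>(0, 1)\<close> along it means letting
  \<open>v\<close> tend to infinity, so only large \<open>v\<close> count.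

  Without an atom the excess over \<open>v + t0\<close> must be shown to be linear in
  \<open>n\<close>. Multiplying the surplus of the horizontal weights by a large \<kappa> forces any
  prescribed linear growth of the modified passage time, while the excess grows at most by the
  factor \<kappa>. Dividing by \<kappa> leaves a positive gap.\<close>

fun directed_time :: "(int \<times> int \<Rightarrow> real) \<Rightarrow> nat \<Rightarrow> int \<Rightarrow> int \<Rightarrow> real" where
  "directed_time \<omega> 0 a b = real_of_int \<bar>a - b\<bar>"
| "directed_time \<omega> (Suc n) a b =
     (INF y. directed_time \<omega> n a y + \<bar>\<omega> (int n, y)\<bar> + real_of_int \<bar>y - b\<bar>)"

declare directed_time.simps(2) [simp del]

lemma directed_time_nonneg: "0 \<le> directed_time \<omega> n a b"
  by (induction n arbitrary: b) (auto simp: directed_time.simps(2) intro!: cINF_greatest add_nonneg_nonneg)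

text \<open>The absolute values around the weights in the recursion make this true for every
  environment, so no null set has to be excluded at this stage.\<close>

lemma directed_time_bdd_below:
  "bdd_below (range (\<lambda>y. directed_time \<omega> n a y + \<bar>\<omega> (int n, y)\<bar> + real_of_int \<bar>y - b\<bar>))"
  by (rule bdd_belowI[of _ 0]) (auto intro!: add_nonneg_nonneg directed_time_nonneg)

lemma directed_time_Suc_le:
  "directed_time \<omega> (Suc n) a b \<le> directed_time \<omega> n a y + \<bar>\<omega> (int n, y)\<bar> + real_of_int \<bar>y - b\<bar>"
  unfolding directed_time.simps(2) by (rule cINF_lower[OF directed_time_bdd_below]) simp

lemma directed_time_Suc_approx:
  assumes "\<epsilon> > 0"
  obtains y where
    "directed_time \<omega> n a y + \<bar>\<omega> (int n, y)\<bar> + real_of_int \<bar>y - b\<bar> < directed_time \<omega> (Suc n) a b + \<epsilon>"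
proof -
  have "directed_time \<omega> (Suc n) a b < directed_time \<omega> (Suc n) a b + \<epsilon>"
    using assms by simp
  then have "Inf (range (\<lambda>y. directed_time \<omega> n a y + \<bar>\<omega> (int n, y)\<bar> + real_of_int \<bar>y - b\<bar>))
      < directed_time \<omega> (Suc n) a b + \<epsilon>"
    by (simp only: directed_time.simps)
  from cInf_lessD[OF _ this] show thesis
    using that by blast
qed

lemma directed_time_Suc_greatest:
  assumes "\<And>y. c \<le> directed_time \<omega> n a y + \<bar>\<omega> (int n, y)\<bar> + real_of_int \<bar>y - b\<bar>"
  shows "c \<le> directed_time \<omega> (Suc n) a b"
  using assms unfolding directed_time.simps(2) by (auto intro!: cINF_greatest)

text \<open>Append the vertical segment from \<open>b'\<close> to \<open>b\<close>. In the recursion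
  it only lengthens the last vertical move, so a case distinction replaces induction.\<close>

lemma directed_time_Lipschitz:
  "directed_time \<omega> n a b \<le> directed_time \<omega> n a b' + real_of_int \<bar>b - b'\<bar>"
proof (cases n)
  case (Suc k)
  have "directed_time \<omega> (Suc k) a b - real_of_int \<bar>b - b'\<bar> \<le> directed_time \<omega> (Suc k) a b'"
  proof (rule directed_time_Suc_greatest)
    fix y
    show "directed_time \<omega> (Suc k) a b - real_of_int \<bar>b - b'\<bar>
        \<le> directed_time \<omega> k a y + \<bar>\<omega> (int k, y)\<bar> + real_of_int \<bar>y - b'\<bar>"
      using directed_time_Suc_le[of \<omega> k a b y] by linarith
  qed
  then show ?thesis by (simp add: Suc)
qed simp

text \<open>Drop the last horizontal edge; the remaining move from \<open>y\<close> to
  \<open>b\<close> is paid by the Lipschitz bound. This is the precise sense in which steps to the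
  left never help.\<close>

lemma directed_time_mono_Suc: "directed_time \<omega> n a b \<le> directed_time \<omega> (Suc n) a b"
proof (rule directed_time_Suc_greatest)
  fix y
  show "directed_time \<omega> n a b \<le> directed_time \<omega> n a y + \<bar>\<omega> (int n, y)\<bar> + real_of_int \<bar>y - b\<bar>"
    using directed_time_Lipschitz[of \<omega> n a b y] by linarith
qed

lemma directed_time_mono: "n \<le> m \<Longrightarrow> directed_time \<omega> n a b \<le> directed_time \<omega> m a b"
  by (rule lift_Suc_mono_le[of "\<lambda>n. directed_time \<omega> n a b"]) (rule directed_time_mono_Suc)

lemma directed_time_cong:
  assumes "\<And>x y. 0 \<le> x \<Longrightarrow> x < int n \<Longrightarrow> \<omega> (x, y) = \<omega>' (x, y)"
  shows "directed_time \<omega> n a b = directed_time \<omega>' n a b"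
  using assms by (induction n arbitrary: b) (simp_all add: directed_time.simps(2))

lemma directed_time_lower:
  assumes "\<And>z. t \<le> \<omega> z"
  shows "t * real n + real_of_int (b - a) \<le> directed_time \<omega> n a b"
proof (induction n arbitrary: b)
  case (Suc n)
  show ?case
  proof (rule directed_time_Suc_greatest)
    fix y
    show "t * real (Suc n) + real_of_int (b - a)
      \<le> directed_time \<omega> n a y + \<bar>\<omega> (int n, y)\<bar> + real_of_int \<bar>y - b\<bar>"
      using Suc[of y] assms[of "(int n, y)"] by (simp add: algebra_simps)
  qed
qed simp

definition shift_env :: "nat \<Rightarrow> int \<Rightarrow> (int \<times> int \<Rightarrow> real) \<Rightarrow> int \<times> int \<Rightarrow> real" where
  "shift_env n c \<omega> z = \<omega> (fst z + int n, snd z + c)"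

text \<open>Writing the second leg in a translated environment gives it the law of a time started at
  the origin, as subadditivity of the means requires.\<close>

lemma directed_time_concat:
  "directed_time \<omega> (n + m) a (c + b) \<le> directed_time \<omega> n a c + directed_time (shift_env n c \<omega>) m 0 b"
proof (induction m arbitrary: b)
  case 0
  show ?case using directed_time_Lipschitz[of \<omega> n a "c + b" c] by simp
next
  case (Suc m)
  have "directed_time \<omega> (n + Suc m) a (c + b) - directed_time \<omega> n a c
      \<le> directed_time (shift_env n c \<omega>) (Suc m) 0 b"
  proof (rule directed_time_Suc_greatest)
    fix y
    have "directed_time \<omega> (n + Suc m) a (c + b)
        \<le> directed_time \<omega> (n + m) a (c + y) + \<bar>\<omega> (int (n + m), c + y)\<bar> + real_of_int \<bar>c + y - (c + b)\<bar>"
      using directed_time_Suc_le[of \<omega> "n + m" a "c + b" "c + y"] by simp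
    moreover have "\<omega> (int (n + m), c + y) = shift_env n c \<omega> (int m, y)"
      by (simp add: shift_env_def add.commute[of "int n"] add.commute[of c])
    ultimately show "directed_time \<omega> (n + Suc m) a (c + b) - directed_time \<omega> n a c
        \<le> directed_time (shift_env n c \<omega>) m 0 y + \<bar>shift_env n c \<omega> (int m, y)\<bar> + real_of_int \<bar>y - b\<bar>"
      using Suc[of y] by simp
  qed
  then show ?case by simp
qed

text \<open>The height \<open>y\<close> is the one at which an almost optimal path crosses column \<open>k\<close>. It depends on
  \<open>\<omega>\<close> only, hence is independent of a resampled column.\<close>
lemma directed_time_resample:
  assumes "k < n" "\<epsilon> > 0"
  shows "\<exists>y. \<forall>\<omega>' j. (\<forall>x z. x \<noteq> int k \<longrightarrow> \<omega>' (x, z) = \<omega> (x, z)) \<longrightarrow>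
    directed_time \<omega>' n a b \<le> directed_time \<omega> n a b + \<epsilon> + \<bar>\<omega>' (int k, y + j)\<bar> + 2 * real_of_int \<bar>j\<bar>"
  using assms
proof (induction n arbitrary: b \<epsilon>)
  case (Suc n)
  obtain y0 where y0: "directed_time \<omega> n a y0 + \<bar>\<omega> (int n, y0)\<bar> + real_of_int \<bar>y0 - b\<bar>
      < directed_time \<omega> (Suc n) a b + \<epsilon> / 2"
    using directed_time_Suc_approx[OF half_gt_zero[OF Suc.prems(2)]] by blast
  show ?case
  proof (cases "k = n")
    \<comment> \<open>Walking by \<open>j\<close> before the edge and back by \<open>j\<close> after
      it accounts for \<open>2 * \<bar>j\<bar>\<close>.\<close>
    case True
    have "directed_time \<omega>' (Suc n) a b \<le> directed_time \<omega> (Suc n) a b + \<epsilon> + \<bar>\<omega>' (int k, y0 + j)\<bar>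
        + 2 * real_of_int \<bar>j\<bar>" if *: "\<forall>x z. x \<noteq> int k \<longrightarrow> \<omega>' (x, z) = \<omega> (x, z)" for \<omega>' j
    proof -
      have "directed_time \<omega>' n a (y0 + j) = directed_time \<omega> n a (y0 + j)"
        by (rule directed_time_cong) (use * True in auto)
      then show ?thesis
        using directed_time_Suc_le[of \<omega>' n a b "y0 + j"] directed_time_Lipschitz[of \<omega> n a "y0 + j" y0]
          y0 Suc.prems unfolding True by linarith
    qed
    then show ?thesis by blast
  next
    case False
    then obtain y where y: "\<And>\<omega>' j. (\<forall>x z. x \<noteq> int k \<longrightarrow> \<omega>' (x, z) = \<omega> (x, z)) \<Longrightarrow>
      directed_time \<omega>' n a y0 \<le> directed_time \<omega> n a y0 + \<epsilon> / 2 + \<bar>\<omega>' (int k, y + j)\<bar> + 2 * real_of_int \<bar>j\<bar>"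
      using Suc.IH[OF _ half_gt_zero[OF Suc.prems(2)], of y0] Suc.prems(1) by (metis less_SucE)
    have "directed_time \<omega>' (Suc n) a b \<le> directed_time \<omega> (Suc n) a b + \<epsilon> + \<bar>\<omega>' (int k, y + j)\<bar>
        + 2 * real_of_int \<bar>j\<bar>" if *: "\<forall>x z. x \<noteq> int k \<longrightarrow> \<omega>' (x, z) = \<omega> (x, z)" for \<omega>' j
    proof -
      have "\<omega>' (int n, y0) = \<omega> (int n, y0)"
        using * False by auto
      then show ?thesis
        using directed_time_Suc_le[of \<omega>' n a b y0] y[OF *, of j] y0 by linarith
    qed
    then show ?thesis by blast
  qed
qed simp

text \<open>The excess of a path over the trivial bound \<open>t * n + (b - a)\<close> consists of its downward steps
  and of the surplus of its horizontal weights. Scaling the surplus by \<open>\<kappa>\<close> therefore scales the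
  excess by at most \<open>\<kappa>\<close>.\<close>
lemma directed_time_tilt:
  assumes "\<kappa> \<ge> 1" "\<And>z. t \<le> \<omega> z" "0 \<le> t"
  shows "directed_time (\<lambda>z. \<kappa> * (\<omega> z - t)) n a b
    \<le> \<kappa> * (directed_time \<omega> n a b - t * real n - real_of_int (b - a)) + real_of_int (b - a)"
proof (induction n arbitrary: b)
  case 0
  \<comment> \<open>\<open>\<bar>a - b\<bar> - (b - a)\<close> is twice the downward part of the
    vertical move, hence nonnegative.\<close>
  have "0 \<le> (\<kappa> - 1) * (real_of_int \<bar>a - b\<bar> - real_of_int (b - a))"
    using assms by (intro mult_nonneg_nonneg) auto
  then show ?case by (simp add: algebra_simps)
next
  case (Suc n)
  let ?D' = "directed_time (\<lambda>z. \<kappa> * (\<omega> z - t))"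
  \<comment> \<open>The claim solved for the directed time, so that it can be checked for each
    crossing height \<open>y\<close> separately.\<close>
  have "(?D' (Suc n) a b - real_of_int (b - a)) / \<kappa> + t * real (Suc n) + real_of_int (b - a)
      \<le> directed_time \<omega> (Suc n) a b"
  proof (rule directed_time_Suc_greatest)
    fix y
    have "?D' (Suc n) a b \<le> ?D' n a y + \<kappa> * (\<omega> (int n, y) - t) + real_of_int \<bar>y - b\<bar>"
      using directed_time_Suc_le[of "\<lambda>z. \<kappa> * (\<omega> z - t)" n a b y] assms
      by (simp add: abs_mult)
    moreover have "0 \<le> (\<kappa> - 1) * (real_of_int \<bar>y - b\<bar> - real_of_int (b - y))"
      using assms by (intro mult_nonneg_nonneg) auto
    ultimately have "?D' (Suc n) a b - real_of_int (b - a) \<le> \<kappa> * (directed_time \<omega> n a y + \<omega> (int n, y)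
        + real_of_int \<bar>y - b\<bar> - t * real (Suc n) - real_of_int (b - a))"
      using Suc[of y] by (simp add: algebra_simps)
    then have "(?D' (Suc n) a b - real_of_int (b - a)) / \<kappa> \<le> directed_time \<omega> n a y + \<omega> (int n, y)
        + real_of_int \<bar>y - b\<bar> - t * real (Suc n) - real_of_int (b - a)"
      using assms(1) by (simp add: divide_le_eq mult.commute)
    then show "(?D' (Suc n) a b - real_of_int (b - a)) / \<kappa> + t * real (Suc n) + real_of_int (b - a)
      \<le> directed_time \<omega> n a y + \<bar>\<omega> (int n, y)\<bar> + real_of_int \<bar>y - b\<bar>"
      by linarith
  qed
  then have "(?D' (Suc n) a b - real_of_int (b - a)) / \<kappa>
     \<le> directed_time \<omega> (Suc n) a b - t * real (Suc n) - real_of_int (b - a)"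
    by linarith
  then show ?case
    using assms(1) by (simp only: divide_le_eq) (simp add: mult.commute)
qed

section \<open>Lattice paths and their comparison with directed times\<close>

lemma lattice_adj_cases:
  assumes "lattice_adj u w"
  obtains "w = (fst u + 1, snd u)" | "u = (fst w + 1, snd w)" | "fst u = fst w" "\<bar>snd u - snd w\<bar> = 1"
proof -
  have "fst w = fst u + 1 \<and> snd w = snd u \<or> fst u = fst w + 1 \<and> snd u = snd w
      \<or> fst u = fst w \<and> \<bar>snd u - snd w\<bar> = 1"
    using assms unfolding lattice_adj_def by linarith
  then show thesis using that by (metis prod.collapse)
qed

text \<open>An unordered horizontal edge determines its left endpoint, so the definite description
  in \<open>edge_weight\<close> is well defined.\<close>

lemma edge_weight_horizontal: "edge_weight \<omega> {z, (fst z + 1, snd z)} = \<omega> z"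
proof -
  have "z' = z" if "{z, (fst z + 1, snd z)} = {z', (fst z' + 1, snd z')}" for z'
    using that by (auto simp: doubleton_eq_iff prod_eq_iff)
  then have "(THE z'. {z, (fst z + 1, snd z)} = {z', (fst z' + 1, snd z')}) = z"
    by (intro the_equality) auto
  then show ?thesis unfolding edge_weight_def by (metis (no_types, lifting))
qed

lemma edge_weight_vertical:
  assumes "fst u = fst w" "u \<noteq> w"
  shows "edge_weight \<omega> {u, w} = 1"
proof -
  have "\<not> (\<exists>z. {u, w} = {z, (fst z + 1, snd z)})"
    using assms by (auto simp: doubleton_eq_iff)
  then show ?thesis unfolding edge_weight_def by simp
qed

lemma edge_weight_nonneg: "(\<And>z. 0 \<le> \<omega> z) \<Longrightarrow> 0 \<le> edge_weight \<omega> e"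
  unfolding edge_weight_def by simp

lemma finite_path_edges: "finite (path_edges p)"
proof -
  have "path_edges p = (\<lambda>k. {p ! k, p ! Suc k}) ` {k. Suc k < length p}"
    unfolding path_edges_def by auto
  moreover have "finite {k. Suc k < length p}"
    by (rule finite_subset[of _ "{..<length p}"]) auto
  ultimately show ?thesis by simp
qed

lemma path_time_nonneg: "(\<And>z. 0 \<le> \<omega> z) \<Longrightarrow> 0 \<le> path_time \<omega> p"
  unfolding path_time_def by (intro sum_nonneg edge_weight_nonneg) auto

lemma passage_time_le:
  "(\<And>z. 0 \<le> \<omega> z) \<Longrightarrow> lattice_path p u w \<Longrightarrow> passage_time \<omega> u w \<le> path_time \<omega> p"
  unfolding passage_time_def
  by (rule cInf_lower) (auto intro!: bdd_belowI[of _ 0] path_time_nonneg)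

lemma path_edges_singleton: "path_edges [u] = {}"
  unfolding path_edges_def by auto

lemma path_edges_Cons: "path_edges (u # w # p) = insert {u, w} (path_edges (w # p))"
proof -
  have "\<exists>j. {(u # w # p) ! k, (u # w # p) ! Suc k} = {(w # p) ! j, (w # p) ! Suc j} \<and> Suc j < length (w # p)"
    if "Suc k < length (u # w # p)" "{(u # w # p) ! k, (u # w # p) ! Suc k} \<noteq> {u, w}" for k
    using that by (cases k) auto
  moreover have "\<exists>k. {(w # p) ! j, (w # p) ! Suc j} = {(u # w # p) ! k, (u # w # p) ! Suc k} \<and> Suc k < length (u # w # p)"
    if "Suc j < length (w # p)" for j
    using that by (intro exI[of _ "Suc j"]) auto
  moreover have "\<exists>k. {u, w} = {(u # w # p) ! k, (u # w # p) ! Suc k} \<and> Suc k < length (u # w # p)"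
    by (intro exI[of _ 0]) auto
  ultimately show ?thesis unfolding path_edges_def by blast
qed

lemma path_edges_vertex: "e \<in> path_edges p \<Longrightarrow> e \<subseteq> set p"
  unfolding path_edges_def by auto

lemma path_edges_suffix: "path_edges (w # q) \<subseteq> path_edges (xs @ w # q)"
proof (induction xs)
  case (Cons x xs)
  then show ?case by (cases xs) (auto simp: path_edges_Cons)
qed simp

lemma lattice_path_Cons:
  "lattice_path (u # w # p) a b \<longleftrightarrow> a = u \<and> lattice_adj u w \<and> lattice_path (w # p) w b"
proof -
  have "(\<forall>k. Suc k < length (u # w # p) \<longrightarrow> lattice_adj ((u # w # p) ! k) ((u # w # p) ! Suc k))
    \<longleftrightarrow> lattice_adj u w \<and> (\<forall>k. Suc k < length (w # p) \<longrightarrow> lattice_adj ((w # p) ! k) ((w # p) ! Suc k))"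
    (is "?L \<longleftrightarrow> ?R")
  proof
    assume ?L
    then have "lattice_adj ((u # w # p) ! Suc k) ((u # w # p) ! Suc (Suc k))" if "Suc k < length (w # p)" for k
      using that by (metis Suc_less_eq length_Cons)
    with \<open>?L\<close> show ?R by auto
  next
    assume ?R
    then show ?L by (auto simp: less_Suc_eq_0_disj nth_Cons split: nat.split)
  qed
  then show ?thesis unfolding lattice_path_def by auto
qed

lemma lattice_path_suffix: "lattice_path (xs @ w # q) a b \<Longrightarrow> lattice_path (w # q) w b"
proof (induction xs arbitrary: a)
  case Nil
  then show ?case by (auto simp: lattice_path_def)
next
  case (Cons x xs)
  then show ?case by (cases xs) (auto simp: lattice_path_Cons)
qed

text \<open>A path counts every edge once; returning to the start is cut off first, so the first
  edge does not occur again.\<close>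
lemma potential_le_path_time:
  assumes \<omega>: "\<And>z. 0 \<le> \<omega> z"
    and f: "\<And>u w. lattice_adj u w \<Longrightarrow> f w - f u \<le> edge_weight \<omega> {u, w}"
    and "lattice_path p u w"
  shows "f w - f u \<le> path_time \<omega> p"
  using assms(3)
proof (induction "length p" arbitrary: p u rule: less_induct)
  case less
  then obtain r where p: "p = u # r"
    by (cases p) (auto simp: lattice_path_def)
  show ?case
  proof (cases "u \<in> set r")
    case True
    then obtain xs ys where r: "r = xs @ u # ys"
      by (auto simp: in_set_conv_decomp)
    have "lattice_path (u # ys) u w"
      using less.prems lattice_path_suffix[of "u # xs" u ys] unfolding p r by simp
    then have "f w - f u \<le> path_time \<omega> (u # ys)"
      by (intro less.hyps) (auto simp: p r)
    also have "\<dots> \<le> path_time \<omega> p"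
      unfolding path_time_def p r
      using path_edges_suffix[of u ys "u # xs"]
      by (intro sum_mono2 finite_path_edges edge_weight_nonneg \<omega>) auto
    finally show ?thesis .
  next
    case False
    show ?thesis
    proof (cases r)
      case Nil
      then have "w = u" using less.prems by (auto simp: p lattice_path_def)
      then show ?thesis using path_time_nonneg[OF \<omega>] by simp
    next
      case (Cons v q)
      have adj: "lattice_adj u v" and path: "lattice_path r v w"
        using less.prems by (auto simp: p Cons lattice_path_Cons)
      have "{u, v} \<notin> path_edges r"
        using False path_edges_vertex by blast
      then have "path_time \<omega> p = edge_weight \<omega> {u, v} + path_time \<omega> r"
        unfolding path_time_def p Cons path_edges_Cons
        by (subst sum.insert) (auto simp: finite_path_edges)
      moreover have "f w - f v \<le> path_time \<omega> r"
        by (rule less.hyps[OF _ path]) (simp add: p)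
      ultimately show ?thesis using f[OF adj] by simp
    qed
  qed
qed

lemma path_edges_snoc:
  assumes "p \<noteq> []"
  shows "path_edges (p @ [w]) = insert {last p, w} (path_edges p)"
  using assms
proof (induction p)
  case (Cons x p)
  then show ?case by (cases p) (auto simp: path_edges_Cons path_edges_singleton)
qed simp

lemma lattice_path_snoc:
  assumes "lattice_path p u v" "lattice_adj v w"
  shows "lattice_path (p @ [w]) u w"
  using assms
proof (induction p arbitrary: u)
  case (Cons x p)
  then show ?case
    by (cases p) (auto simp: lattice_path_Cons, auto simp: lattice_path_def)
qed (simp add: lattice_path_def)

lemma lattice_path_extend_vertically:
  "lattice_path p u v \<Longrightarrow> fst v = fst w \<Longrightarrow>
     \<exists>q. lattice_path q u w \<and> path_time \<omega> q \<le> path_time \<omega> p + real_of_int \<bar>snd v - snd w\<bar>"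
proof (induction "nat \<bar>snd v - snd w\<bar>" arbitrary: w)
  case 0
  then have "v = w" by (auto simp: prod_eq_iff)
  then show ?case using 0 by auto
next
  case (Suc d)
  \<comment> \<open>The neighbour of \<open>w\<close> one step nearer to \<open>v\<close>.\<close>
  define w' where "w' = (fst w, if snd v < snd w then snd w - 1 else snd w + 1)"
  have w': "d = nat \<bar>snd v - snd w'\<bar>" "fst v = fst w'" "lattice_adj w' w" "w' \<noteq> w" "fst w' = fst w"
    "\<bar>snd v - snd w'\<bar> = \<bar>snd v - snd w\<bar> - 1"
    using Suc(2,4) by (auto simp: w'_def lattice_adj_def prod_eq_iff)
  obtain q where q: "lattice_path q u w'" "path_time \<omega> q \<le> path_time \<omega> p + real_of_int \<bar>snd v - snd w'\<bar>"
    using Suc(1)[OF w'(1) Suc(3) w'(2)] by auto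
  have "last q = w'" "q \<noteq> []"
    using q by (auto simp: lattice_path_def)
  \<comment> \<open>Only an inequality: if the new edge already lies on \<open>q\<close>, it is not
    counted a second time.\<close>
  then have "path_time \<omega> (q @ [w]) \<le> path_time \<omega> q + 1"
    unfolding path_time_def using w'
    by (cases "{w', w} \<in> path_edges q")
       (auto simp: path_edges_snoc insert_absorb finite_path_edges edge_weight_vertical)
  then show ?case
    using lattice_path_snoc[OF q(1) w'(3)] q(2) w'(6) by (intro exI[of _ "q @ [w]"]) auto
qed

lemma lattice_path_near_directed_time:
  assumes \<omega>: "\<And>z. 0 \<le> \<omega> z" and "\<epsilon> > 0"
  shows "\<exists>p. lattice_path p (0, a) (int n, b) \<and> path_time \<omega> p \<le> directed_time \<omega> n a b + \<epsilon>"
  using assms(2)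
proof (induction n arbitrary: b \<epsilon>)
  case 0
  have "lattice_path [(0, a)] (0, a) (0, a)"
    by (simp add: lattice_path_def)
  from lattice_path_extend_vertically[OF this, of "(0, b)" \<omega>] 0 show ?case
    by (auto simp: path_time_def path_edges_singleton intro: order_trans)
next
  case (Suc n)
  obtain y where y: "directed_time \<omega> n a y + \<bar>\<omega> (int n, y)\<bar> + real_of_int \<bar>y - b\<bar>
      < directed_time \<omega> (Suc n) a b + \<epsilon> / 2"
    using directed_time_Suc_approx[OF half_gt_zero[OF Suc.prems]] by blast
  obtain p where p: "lattice_path p (0, a) (int n, y)" "path_time \<omega> p \<le> directed_time \<omega> n a y + \<epsilon> / 2"
    using Suc.IH[of "\<epsilon> / 2" y] Suc.prems by auto
  have adj: "lattice_adj (int n, y) (int n + 1, y)"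
    by (simp add: lattice_adj_def)
  have "last p = (int n, y)" "p \<noteq> []"
    using p by (auto simp: lattice_path_def)
  moreover have "edge_weight \<omega> {(int n, y), (int n + 1, y)} = \<omega> (int n, y)"
    using edge_weight_horizontal[of \<omega> "(int n, y)"] by simp
  ultimately have "path_time \<omega> (p @ [(int n + 1, y)]) \<le> path_time \<omega> p + \<omega> (int n, y)"
    unfolding path_time_def using \<omega>[of "(int n, y)"]
    by (cases "{(int n, y), (int n + 1, y)} \<in> path_edges p")
       (auto simp: path_edges_snoc insert_absorb finite_path_edges)
  moreover obtain q where "lattice_path q (0, a) (int n + 1, b)"
     "path_time \<omega> q \<le> path_time \<omega> (p @ [(int n + 1, y)]) + real_of_int \<bar>y - b\<bar>"
    using lattice_path_extend_vertically[OF lattice_path_snoc[OF p(1) adj], of "(int n + 1, b)" \<omega>] by auto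
  ultimately show ?case
    using p(2) y \<omega>[of "(int n, y)"] by (intro exI[of _ q]) (auto simp: add.commute)
qed

text \<open>The directed time from \<open>(0, a)\<close> is a potential that grows along every edge
  by at most the weight of the edge. For a step to the left this is monotonicity in the number of
  columns.\<close>

lemma directed_time_le_path_time:
  assumes \<omega>: "\<And>z. 0 \<le> \<omega> z" and "lattice_path p (0, a) (int n, b)"
  shows "directed_time \<omega> n a b \<le> path_time \<omega> p"
proof -
  \<comment> \<open>\<open>nat\<close> collapses all columns with negative abscissa onto column 0,
    where crossing a horizontal edge leaves the potential unchanged.\<close>
  define f where "f z = directed_time \<omega> (nat (fst z)) a (snd z)" for z :: "int \<times> int"
  have right: "f (x + 1, y) \<le> f (x, y) + \<omega> (x, y)" for x y
  proof (cases "0 \<le> x")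
    case True
    then have "nat (x + 1) = Suc (nat x)" by simp
    with True \<omega>[of "(x, y)"] show ?thesis
      using directed_time_Suc_le[of \<omega> "nat x" a y y] by (simp add: f_def)
  qed (use \<omega>[of "(x, y)"] in \<open>simp add: f_def\<close>)
  have left: "f (x, y) \<le> f (x + 1, y) + \<omega> (x, y)" for x y
  proof -
    have "f (x, y) \<le> f (x + 1, y)" by (simp add: f_def directed_time_mono)
    then show ?thesis using \<omega>[of "(x, y)"] by linarith
  qed
  have "f w - f u \<le> edge_weight \<omega> {u, w}" if "lattice_adj u w" for u w
    using that
  proof (cases rule: lattice_adj_cases)
    case 1
    then show ?thesis using right[of "fst u" "snd u"] edge_weight_horizontal[of \<omega> u] by simp
  next
    case 2
    then show ?thesis using left[of "fst w" "snd w"] edge_weight_horizontal[of \<omega> w]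
      by (simp add: insert_commute)
  next
    case 3
    then have "u \<noteq> w" by auto
    with 3 have "edge_weight \<omega> {u, w} = 1" by (intro edge_weight_vertical)
    moreover have "real_of_int \<bar>snd w - snd u\<bar> = 1" using 3 by linarith
    ultimately show ?thesis
      using directed_time_Lipschitz[of \<omega> "nat (fst u)" a "snd w" "snd u"] 3 by (simp add: f_def)
  qed
  from potential_le_path_time[OF \<omega> this assms(2)] show ?thesis by (simp add: f_def)
qed

lemma passage_time_eq_directed_time:
  assumes \<omega>: "\<And>z. 0 \<le> \<omega> z"
  shows "passage_time \<omega> (0, a) (int n, b) = directed_time \<omega> n a b"
proof (rule antisym)
  show "passage_time \<omega> (0, a) (int n, b) \<le> directed_time \<omega> n a b"
  proof (rule field_le_epsilon)
    fix \<epsilon> :: real assume "\<epsilon> > 0"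
    then obtain p where "lattice_path p (0, a) (int n, b)" "path_time \<omega> p \<le> directed_time \<omega> n a b + \<epsilon>"
      using lattice_path_near_directed_time[of \<omega> \<epsilon>] \<omega> by blast
    then show "passage_time \<omega> (0, a) (int n, b) \<le> directed_time \<omega> n a b + \<epsilon>"
      using passage_time_le[of \<omega>] \<omega> by fastforce
  qed
  have "\<exists>p. lattice_path p (0, a) (int n, b)"
    using lattice_path_near_directed_time[of \<omega> 1 a n b] \<omega> by auto
  then show "directed_time \<omega> n a b \<le> passage_time \<omega> (0, a) (int n, b)"
    unfolding passage_time_def by (intro cInf_greatest) (auto intro: directed_time_le_path_time \<omega>)
qed

section \<open>Swapping coordinates in product spaces\<close>

text \<open>The first component is the first copy with the coordinates in \<open>S\<close>
  resampled. Keeping the second component as well makes the map an involution that preserves the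
  product measure.\<close>

definition swap_on :: "'i set \<Rightarrow> ('i \<Rightarrow> 'a) \<times> ('i \<Rightarrow> 'a) \<Rightarrow> ('i \<Rightarrow> 'a) \<times> ('i \<Rightarrow> 'a)" where
  "swap_on S p = (\<lambda>i. if i \<in> S then snd p i else fst p i, \<lambda>i. if i \<in> S then fst p i else snd p i)"

lemma swap_on_swap_on: "swap_on S (swap_on U p) = swap_on ((S - U) \<union> (U - S)) p"
  by (auto simp: swap_on_def fun_eq_iff)

lemma swap_on_empty [simp]: "swap_on {} p = p"
  by (simp add: swap_on_def)

lemma measurable_swap_on [measurable]:
  "swap_on S \<in> (\<Pi>\<^sub>M i\<in>UNIV. N) \<Otimes>\<^sub>M (\<Pi>\<^sub>M i\<in>UNIV. N) \<rightarrow>\<^sub>M (\<Pi>\<^sub>M i\<in>UNIV. N) \<Otimes>\<^sub>M (\<Pi>\<^sub>M i\<in>UNIV. N)"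
proof -
  have "(\<lambda>p. if i \<in> S then snd p i else fst p i) \<in> (\<Pi>\<^sub>M i\<in>UNIV. N) \<Otimes>\<^sub>M (\<Pi>\<^sub>M i\<in>UNIV. N) \<rightarrow>\<^sub>M N" for S and i :: 'a
    by (cases "i \<in> S") simp_all
  from this[of _ S] this[of _ "- S"] show ?thesis
    unfolding swap_on_def by (intro measurable_Pair measurable_abs_UNIV) (simp_all cong: if_cong)
qed

text \<open>Both copies together form a product over \<open>bool \<times> 'i\<close>, where the swap is a
  permutation of the coordinates.\<close>
lemma distr_swap_on:
  fixes N :: "'a measure"
  assumes "prob_space N"
  defines "M \<equiv> (\<Pi>\<^sub>M i\<in>(UNIV :: 'i set). N)"
  shows "distr (M \<Otimes>\<^sub>M M) (M \<Otimes>\<^sub>M M) (swap_on S) = M \<Otimes>\<^sub>M M"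
proof -
  interpret N: prob_space N by fact
  interpret M: product_prob_space "\<lambda>_. N" "UNIV :: 'i set" ..
  interpret L: product_prob_space "\<lambda>_. N" "UNIV :: (bool \<times> 'i) set" ..
  interpret MM: pair_prob_space M M unfolding M_def ..
  have sf: "sigma_finite_measure M"
    unfolding M_def by (intro prob_space_imp_sigma_finite prob_space_PiM assms)
  define L where "L = (\<Pi>\<^sub>M j\<in>(UNIV :: (bool \<times> 'i) set). N)"
  define \<Phi> :: "('i \<Rightarrow> 'a) \<times> ('i \<Rightarrow> 'a) \<Rightarrow> bool \<times> 'i \<Rightarrow> 'a"
    where "\<Phi> p j = (if fst j then snd p (snd j) else fst p (snd j))" for p j
  define \<Psi> :: "(bool \<times> 'i \<Rightarrow> 'a) \<Rightarrow> ('i \<Rightarrow> 'a) \<times> ('i \<Rightarrow> 'a)"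
    where "\<Psi> \<eta> = (\<lambda>i. \<eta> (False, i), \<lambda>i. \<eta> (True, i))" for \<eta>
  \<comment> \<open>Inequality of truth values is exclusive or: the copy label flips exactly when
    the index lies in \<open>S\<close>.\<close>
  define \<sigma> :: "bool \<times> 'i \<Rightarrow> bool \<times> 'i" where "\<sigma> j = (fst j \<noteq> (snd j \<in> S), snd j)" for j
  have \<Phi>j: "(\<lambda>p. \<Phi> p j) \<in> M \<Otimes>\<^sub>M M \<rightarrow>\<^sub>M N" for j
    unfolding \<Phi>_def M_def by (cases "fst j") simp_all
  then have \<Phi>[measurable]: "\<Phi> \<in> M \<Otimes>\<^sub>M M \<rightarrow>\<^sub>M L"
    unfolding L_def by (rule measurable_abs_UNIV)
  have \<Psi>[measurable]: "\<Psi> \<in> L \<rightarrow>\<^sub>M M \<Otimes>\<^sub>M M"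
    unfolding L_def M_def \<Psi>_def
    by (intro measurable_Pair measurable_abs_UNIV measurable_component_singleton UNIV_I)
  have R[measurable]: "(\<lambda>\<eta> j. \<eta> (\<sigma> j)) \<in> L \<rightarrow>\<^sub>M L"
    unfolding L_def by (intro measurable_abs_UNIV measurable_component_singleton UNIV_I)
  \<comment> \<open>It suffices to compare cylinder sets. A finite set \<open>J\<close> of labelled
    indices splits into the layers \<open>J' False\<close> and \<open>J' True\<close>, one for each
    copy.\<close>
  have A: "distr (M \<Otimes>\<^sub>M M) L \<Phi> = L"
  proof (rule measure_eqI_PiM_infinite)
    show "sets (distr (M \<Otimes>\<^sub>M M) L \<Phi>) = sets (\<Pi>\<^sub>M j\<in>UNIV. N)" "sets L = sets (\<Pi>\<^sub>M j\<in>UNIV. N)"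
      by (simp_all add: L_def)
    show "finite_measure (distr (M \<Otimes>\<^sub>M M) L \<Phi>)"
      by (intro prob_space.finite_measure MM.prob_space_distr \<Phi>)
  next
    fix A and J :: "(bool \<times> 'i) set"
    assume J: "finite J" and A: "\<And>j. j \<in> J \<Longrightarrow> A j \<in> sets N"
    define J' where "J' b = {i. (b, i) \<in> J}" for b
    have fin: "finite (J' b)" for b
      unfolding J'_def using finite_vimageI[OF J, of "Pair b"] by (simp add: vimage_def inj_on_def)
    have A': "A (b, i) \<in> sets N" if "i \<in> J' b" for b i
      using that A by (simp add: J'_def)
    have JJ: "J = Pair False ` J' False \<union> Pair True ` J' True"
      unfolding J'_def by (auto simp: image_iff) (metis (full_types))
    have emb: "prod_emb UNIV (\<lambda>_. N) J (Pi\<^sub>E J A) = {\<eta>\<in>space L. \<forall>j\<in>J. \<eta> j \<in> A j}"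
      by (auto simp: prod_emb_def L_def space_PiM PiE_iff)
    have "prod_emb UNIV (\<lambda>_. N) J (Pi\<^sub>E J A) \<in> sets L"
      unfolding L_def using J A by (intro sets_PiM_I) auto
    then have meas: "{\<eta>\<in>space L. \<forall>j\<in>J. \<eta> j \<in> A j} \<in> sets L"
      unfolding emb .
    have col: "{f\<in>space M. \<forall>i\<in>J' b. f i \<in> A (b, i)} \<in> sets M" for b
    proof -
      have "prod_emb UNIV (\<lambda>_. N) (J' b) (\<Pi>\<^sub>E i\<in>J' b. A (b, i)) \<in> sets M"
        unfolding M_def using fin by (intro sets_PiM_I) (auto simp: A')
      also have "prod_emb UNIV (\<lambda>_. N) (J' b) (\<Pi>\<^sub>E i\<in>J' b. A (b, i)) = {f\<in>space M. \<forall>i\<in>J' b. f i \<in> A (b, i)}"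
        by (auto simp: prod_emb_def M_def space_PiM PiE_iff)
      finally show ?thesis .
    qed
    have "emeasure (distr (M \<Otimes>\<^sub>M M) L \<Phi>) (prod_emb UNIV (\<lambda>_. N) J (Pi\<^sub>E J A))
      = emeasure (M \<Otimes>\<^sub>M M) (\<Phi> -` {\<eta>\<in>space L. \<forall>j\<in>J. \<eta> j \<in> A j} \<inter> space (M \<Otimes>\<^sub>M M))"
      unfolding emb by (rule emeasure_distr[OF \<Phi> meas])
    also have "\<Phi> -` {\<eta>\<in>space L. \<forall>j\<in>J. \<eta> j \<in> A j} \<inter> space (M \<Otimes>\<^sub>M M)
      = {f\<in>space M. \<forall>i\<in>J' False. f i \<in> A (False, i)} \<times> {f\<in>space M. \<forall>i\<in>J' True. f i \<in> A (True, i)}"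
      using measurable_space[OF \<Phi>] unfolding JJ by (auto simp: space_pair_measure \<Phi>_def ball_Un)
    also have "emeasure (M \<Otimes>\<^sub>M M) \<dots> = emeasure M {f\<in>space M. \<forall>i\<in>J' False. f i \<in> A (False, i)}
        * emeasure M {f\<in>space M. \<forall>i\<in>J' True. f i \<in> A (True, i)}"
      by (rule sigma_finite_measure.emeasure_pair_measure_Times[OF sf col col])
    also have "\<dots> = (\<Prod>i\<in>J' False. emeasure N (A (False, i))) * (\<Prod>i\<in>J' True. emeasure N (A (True, i)))"
      unfolding M_def by (subst (1 2) M.emeasure_PiM_Collect) (auto simp: fin A')
    also have "\<dots> = (\<Prod>j\<in>J. emeasure N (A j))"
    proof -
      have "(\<Prod>j\<in>Pair False ` J' False \<union> Pair True ` J' True. emeasure N (A j))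
        = (\<Prod>i\<in>J' False. emeasure N (A (False, i))) * (\<Prod>i\<in>J' True. emeasure N (A (True, i)))"
        by (subst prod.union_disjoint) (auto simp: fin prod.reindex inj_on_def)
      then show ?thesis by (simp only: JJ[symmetric])
    qed
    also have "\<dots> = emeasure L (prod_emb UNIV (\<lambda>_. N) J (Pi\<^sub>E J A))"
      unfolding L_def using J A by (subst L.emeasure_PiM_emb) auto
    finally show "emeasure (distr (M \<Otimes>\<^sub>M M) L \<Phi>) (prod_emb UNIV (\<lambda>_. N) J (Pi\<^sub>E J A))
      = emeasure L (prod_emb UNIV (\<lambda>_. N) J (Pi\<^sub>E J A))" .
  qed
  have B: "distr L L (\<lambda>\<eta> j. \<eta> (\<sigma> j)) = L"
  proof -
    have "inj \<sigma>"
      by (rule inj_on_inverseI[of _ \<sigma>]) (auto simp: \<sigma>_def prod_eq_iff)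
    from distr_PiM_reindex[of UNIV "\<lambda>_. N" \<sigma> UNIV, OF assms(1) this] show ?thesis
      unfolding L_def restrict_UNIV by simp
  qed
  \<comment> \<open>\<open>\<Psi>\<close> inverts \<open>\<Phi>\<close>, so this follows from
    \<open>A\<close>.\<close>
  have C: "distr L (M \<Otimes>\<^sub>M M) \<Psi> = M \<Otimes>\<^sub>M M"
  proof -
    have "distr L (M \<Otimes>\<^sub>M M) \<Psi> = distr (M \<Otimes>\<^sub>M M) (M \<Otimes>\<^sub>M M) (\<Psi> \<circ> \<Phi>)"
      by (subst A[symmetric], subst distr_distr) auto
    also have "\<Psi> \<circ> \<Phi> = (\<lambda>p. p)"
      by (auto simp: \<Psi>_def \<Phi>_def fun_eq_iff)
    finally show ?thesis by simp
  qed
  have "swap_on S = \<Psi> \<circ> ((\<lambda>\<eta> j. \<eta> (\<sigma> j)) \<circ> \<Phi>)"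
    by (auto simp: \<Psi>_def \<Phi>_def \<sigma>_def swap_on_def fun_eq_iff)
  then have "distr (M \<Otimes>\<^sub>M M) (M \<Otimes>\<^sub>M M) (swap_on S)
      = distr (distr (distr (M \<Otimes>\<^sub>M M) L \<Phi>) L (\<lambda>\<eta> j. \<eta> (\<sigma> j))) (M \<Otimes>\<^sub>M M) \<Psi>"
    by (simp add: distr_distr)
  then show ?thesis by (simp add: A B C)
qed

lemma integrable_mult_square:
  fixes f g :: "_ \<Rightarrow> real"
  assumes [measurable]: "f \<in> borel_measurable K" "g \<in> borel_measurable K"
    and "integrable K (\<lambda>x. (f x)\<^sup>2)" "integrable K (\<lambda>x. (g x)\<^sup>2)"
  shows "integrable K (\<lambda>x. f x * g x)"
proof (rule Bochner_Integration.integrable_bound)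
  show "integrable K (\<lambda>x. (f x)\<^sup>2 + (g x)\<^sup>2)" using assms by simp
  have "\<bar>f x * g x\<bar> \<le> (f x)\<^sup>2 + (g x)\<^sup>2" for x
  proof -
    have "2 * \<bar>f x\<bar> * \<bar>g x\<bar> \<le> (f x)\<^sup>2 + (g x)\<^sup>2"
      using sum_squares_bound[of "\<bar>f x\<bar>" "\<bar>g x\<bar>"] by simp
    moreover have "0 \<le> \<bar>f x\<bar> * \<bar>g x\<bar>" by simp
    ultimately show ?thesis unfolding abs_mult by linarith
  qed
  then show "AE x in K. norm (f x * g x) \<le> norm ((f x)\<^sup>2 + (g x)\<^sup>2)" by simp
qed simp

section \<open>Resampling identities and the Efron-Stein inequality\<close>

locale iid_product =
  fixes N :: "'a measure" and M :: "('i \<Rightarrow> 'a) measure"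
  assumes prob_N: "prob_space N" and M_eq: "M = (\<Pi>\<^sub>M i\<in>UNIV. N)"
begin

sublocale prob_space M
  unfolding M_eq by (rule prob_space_PiM) (rule prob_N)

sublocale MM: pair_prob_space M M ..

lemma component_measurable [measurable]: "(\<lambda>\<omega>. \<omega> i) \<in> M \<rightarrow>\<^sub>M N"
  unfolding M_eq by simp

lemma swap_measurable [measurable]: "swap_on S \<in> M \<Otimes>\<^sub>M M \<rightarrow>\<^sub>M M \<Otimes>\<^sub>M M"
  unfolding M_eq by (rule measurable_swap_on)

lemma distr_swap: "distr (M \<Otimes>\<^sub>M M) (M \<Otimes>\<^sub>M M) (swap_on S) = M \<Otimes>\<^sub>M M"
  unfolding M_eq by (rule distr_swap_on[OF prob_N])

lemma nn_integral_swap: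
  assumes [measurable]: "h \<in> borel_measurable (M \<Otimes>\<^sub>M M)"
  shows "(\<integral>\<^sup>+p. h (swap_on S p) \<partial>(M \<Otimes>\<^sub>M M)) = (\<integral>\<^sup>+p. h p \<partial>(M \<Otimes>\<^sub>M M))"
  by (subst (2) distr_swap[of S, symmetric], subst nn_integral_distr) auto

lemma integral_swap:
  fixes h :: "_ \<Rightarrow> real"
  assumes [measurable]: "h \<in> borel_measurable (M \<Otimes>\<^sub>M M)"
  shows "(\<integral>p. h (swap_on S p) \<partial>(M \<Otimes>\<^sub>M M)) = (\<integral>p. h p \<partial>(M \<Otimes>\<^sub>M M))"
  by (subst (2) distr_swap[of S, symmetric], subst integral_distr) auto

lemma integrable_swap:
  fixes h :: "_ \<Rightarrow> real"
  assumes "integrable (M \<Otimes>\<^sub>M M) h"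
  shows "integrable (M \<Otimes>\<^sub>M M) (\<lambda>p. h (swap_on S p))"
  by (rule integrable_distr[of _ _ "M \<Otimes>\<^sub>M M"]) (simp_all add: distr_swap assms)

text \<open>Stands in for independence: in the inner integral the coordinates outside
  \<open>S\<close> are frozen, while those in \<open>S\<close> are fresh.\<close>

lemma nn_integral_mix:
  assumes [measurable]: "h \<in> borel_measurable M"
  shows "(\<integral>\<^sup>+\<omega>. h \<omega> \<partial>M) = (\<integral>\<^sup>+\<omega>. \<integral>\<^sup>+\<omega>'. h (\<lambda>i. if i \<in> S then \<omega>' i else \<omega> i) \<partial>M \<partial>M)"
proof -
  have "(\<integral>\<^sup>+\<omega>. h \<omega> \<partial>M) = (\<integral>\<^sup>+p. h (fst p) \<partial>(M \<Otimes>\<^sub>M M))"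
    by (subst nn_integral_fst[symmetric]) (auto simp: emeasure_space_1)
  also have "\<dots> = (\<integral>\<^sup>+p. h (fst (swap_on S p)) \<partial>(M \<Otimes>\<^sub>M M))"
    by (rule nn_integral_swap[symmetric]) simp
  also have "\<dots> = (\<integral>\<^sup>+\<omega>. \<integral>\<^sup>+\<omega>'. h (fst (swap_on S (\<omega>, \<omega>'))) \<partial>M \<partial>M)"
    by (rule nn_integral_fst[symmetric]) simp
  finally show ?thesis by (simp only: swap_on_def fst_conv snd_conv)
qed

lemma distr_component: "distr M N (\<lambda>\<omega>. \<omega> i) = N"
proof -
  interpret product_prob_space "\<lambda>_. N" "UNIV :: 'i set"
    by (simp add: product_prob_space_def product_prob_space_axioms_def product_sigma_finite_def
        prob_N prob_space_imp_sigma_finite)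
  show ?thesis unfolding M_eq by (rule PiM_component) simp
qed

text \<open>Telescope \<open>X(\<omega>) (X(\<omega>) - X(\<omega>'))\<close> over the hybrids that take the first \<open>k\<close> blocks from the second
  copy; swapping block \<open>k\<close> exchanges two consecutive hybrids.\<close>
lemma Efron_Stein:
  fixes X :: "('i \<Rightarrow> 'a) \<Rightarrow> real" and S :: "nat \<Rightarrow> 'i set"
  assumes X[measurable]: "X \<in> borel_measurable M" and sq: "integrable M (\<lambda>\<omega>. (X \<omega>)\<^sup>2)"
    and dep: "\<And>\<omega> \<omega>'. (\<And>i. i \<in> (\<Union>k<n. S k) \<Longrightarrow> \<omega> i = \<omega>' i) \<Longrightarrow> X \<omega> = X \<omega>'"
    and disj: "disjoint_family S"
  shows "variance X \<le> (\<Sum>k<n. \<integral>p. (X (fst p) - X (fst (swap_on (S k) p)))\<^sup>2 \<partial>(M \<Otimes>\<^sub>M M)) / 2"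
proof -
  let ?P = "M \<Otimes>\<^sub>M M"
  define U where "U k = (\<Union>j<k. S j)" for k
  \<comment> \<open>\<open>Z (U k)\<close> is \<open>X\<close> at the \<open>k\<close>-th hybrid:
    \<open>Z {}\<close> sees only the first copy and, by \<open>Z_snd\<close>,
    \<open>Z (U n)\<close> only the second.\<close>
  define Z where "Z S p = X (fst (swap_on S p))" for S p
  have Zm[measurable]: "Z S \<in> borel_measurable ?P" for S
    unfolding Z_def by simp
  have intX: "integrable M X"
    using square_integrable_imp_integrable[OF X sq] .
  have "integrable ?P (\<lambda>p. (X (fst p))\<^sup>2)"
    using integrable_distr[of fst ?P M "\<lambda>\<omega>. (X \<omega>)\<^sup>2"] sq by (simp add: distr_pair_fst)
  from integrable_swap[OF this] have Zsq: "integrable ?P (\<lambda>p. (Z S p)\<^sup>2)" for S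
    by (simp add: Z_def)
  have Zmult: "integrable ?P (\<lambda>p. Z A p * Z B p)" for A B
    by (intro integrable_mult_square Zsq) simp_all
  have Zswap: "Z A (swap_on B p) = Z ((A - B) \<union> (B - A)) p" for A B p
    by (simp add: Z_def swap_on_swap_on)
  have SU: "S k \<inter> U k = {}" for k
  proof -
    have "S k \<inter> S j = {}" if "j < k" for j
      using disj that by (intro disjoint_family_onD[OF disj]) auto
    then show ?thesis unfolding U_def by blast
  qed
  have U_Suc: "U (Suc k) = U k \<union> S k" for k
    unfolding U_def lessThan_Suc by blast
  have Z_snd: "Z (U n) p = X (snd p)" for p
    unfolding Z_def by (rule dep) (simp add: swap_on_def U_def)
  \<comment> \<open>Average the integral with its image under the swap of block \<open>k\<close>.
    This produces the product of \<open>Z {} - Z (S k)\<close> and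
    \<open>Z (U k) - Z (U (Suc k))\<close>, which is at most half the sum of the squares.\<close>
  have step: "(\<integral>p. Z {} p * (Z (U k) p - Z (U (Suc k)) p) \<partial>?P)
      \<le> (\<integral>p. (Z {} p - Z (S k) p)\<^sup>2 \<partial>?P) / 2" for k
  proof -
    have e: "U k - S k \<union> (S k - U k) = U (Suc k)" "U (Suc k) - S k \<union> (S k - U (Suc k)) = U k"
        "U (Suc k) - U k \<union> (U k - U (Suc k)) = S k"
      using SU[of k] by (auto simp: U_Suc)
    have 1: "(\<integral>p. Z {} p * (Z (U k) p - Z (U (Suc k)) p) \<partial>?P)
      = (\<integral>p. Z (S k) p * (Z (U (Suc k)) p - Z (U k) p) \<partial>?P)"
      by (subst integral_swap[of _ "S k", symmetric]) (simp_all add: Zswap e)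
    \<comment> \<open>Swapping \<open>U k\<close> carries one difference to the other, so the two
      squares have the same mean.\<close>
    have 2: "(\<integral>p. (Z {} p - Z (S k) p)\<^sup>2 \<partial>?P) = (\<integral>p. (Z (U k) p - Z (U (Suc k)) p)\<^sup>2 \<partial>?P)"
      by (subst (2) integral_swap[of _ "U k", symmetric]) (simp_all add: Zswap e)
    have i: "integrable ?P (\<lambda>p. Z A p * (Z B p - Z C p))" "integrable ?P (\<lambda>p. (Z A p - Z B p)\<^sup>2)" for A B C
      by (auto simp: algebra_simps power2_eq_square intro!: Zmult Bochner_Integration.integrable_add
        Bochner_Integration.integrable_diff)
    have "2 * (\<integral>p. Z {} p * (Z (U k) p - Z (U (Suc k)) p) \<partial>?P)
       = (\<integral>p. Z {} p * (Z (U k) p - Z (U (Suc k)) p) \<partial>?P) + (\<integral>p. Z (S k) p * (Z (U (Suc k)) p - Z (U k) p) \<partial>?P)"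
      using 1 by simp
    also have "\<dots> = (\<integral>p. Z {} p * (Z (U k) p - Z (U (Suc k)) p) + Z (S k) p * (Z (U (Suc k)) p - Z (U k) p) \<partial>?P)"
      by (rule Bochner_Integration.integral_add[symmetric]) (rule i)+
    also have "\<dots> \<le> (\<integral>p. ((Z {} p - Z (S k) p)\<^sup>2 + (Z (U k) p - Z (U (Suc k)) p)\<^sup>2) / 2 \<partial>?P)"
    proof (intro integral_mono)
      fix p
      have "0 \<le> ((Z {} p - Z (S k) p) - (Z (U k) p - Z (U (Suc k)) p))\<^sup>2" by simp
      then show "Z {} p * (Z (U k) p - Z (U (Suc k)) p) + Z (S k) p * (Z (U (Suc k)) p - Z (U k) p)
        \<le> ((Z {} p - Z (S k) p)\<^sup>2 + (Z (U k) p - Z (U (Suc k)) p)\<^sup>2) / 2"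
        by (simp add: power2_eq_square algebra_simps)
    qed (intro Bochner_Integration.integrable_add integrable_divide i)+
    also have "\<dots> = (\<integral>p. (Z {} p - Z (S k) p)\<^sup>2 \<partial>?P)"
      using 2 by (simp add: i)
    finally show ?thesis by simp
  qed
  have fst: "(\<integral>p. (Z {} p)\<^sup>2 \<partial>?P) = (\<integral>\<omega>. (X \<omega>)\<^sup>2 \<partial>M)"
    using integral_distr[of fst ?P M "\<lambda>\<omega>. (X \<omega>)\<^sup>2"] by (simp add: distr_pair_fst Z_def)
  have indep: "(\<integral>p. Z {} p * Z (U n) p \<partial>?P) = expectation X * expectation X"
  proof -
    have "integrable ?P (\<lambda>(\<omega>, \<omega>'). X \<omega> * X \<omega>')"
      using Zmult[of "{}" "U n"] unfolding Z_snd by (simp add: Z_def split_beta')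
    from MM.integral_fst'[OF this[unfolded split_beta']] show ?thesis
      unfolding Z_snd by (simp add: Z_def split_beta')
  qed
  have "variance X = (\<integral>p. Z {} p * Z {} p \<partial>?P) - (\<integral>p. Z {} p * Z (U n) p \<partial>?P)"
    using variance_eq[OF intX sq] fst by (simp add: indep power2_eq_square)
  also have "\<dots> = (\<integral>p. Z {} p * (Z {} p - Z (U n) p) \<partial>?P)"
    by (simp add: right_diff_distrib Zmult)
  also have "\<dots> = (\<integral>p. (\<Sum>k<n. Z {} p * (Z (U k) p - Z (U (Suc k)) p)) \<partial>?P)"
  proof -
    have "(\<Sum>k<n. Z (U k) p - Z (U (Suc k)) p) = Z {} p - Z (U n) p" for p
      using sum_lessThan_telescope'[of "\<lambda>k. Z (U k) p" n] by (simp add: U_def)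
    then show ?thesis by (simp add: sum_distrib_left[symmetric])
  qed
  also have "\<dots> = (\<Sum>k<n. \<integral>p. Z {} p * (Z (U k) p - Z (U (Suc k)) p) \<partial>?P)"
    by (rule Bochner_Integration.integral_sum) (simp add: right_diff_distrib Zmult)
  also have "\<dots> \<le> (\<Sum>k<n. (\<integral>p. (Z {} p - Z (S k) p)\<^sup>2 \<partial>?P) / 2)"
    by (rule sum_mono) (rule step)
  finally show ?thesis by (simp add: Z_def sum_divide_distrib)
qed

end

section \<open>Variance of the passage time\<close>

text \<open>The search goes upwards only, which already gives a geometric tail and keeps the greedy
  paths below free of descents. If there is no hit, the value is unspecified; \<open>AE_hit\<close>
  excludes this almost surely.\<close>

definition first_hit :: "real set \<Rightarrow> (int \<times> int \<Rightarrow> real) \<Rightarrow> int \<times> int \<Rightarrow> nat" where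
  "first_hit B \<omega> z = (LEAST k. \<omega> (fst z, snd z + int k) \<in> B)"

text \<open>Differentiating the geometric series twice gives the coefficients
  \<open>(n + 1) * (n + 2)\<close>, which dominate the squares.\<close>

lemma summable_square_geometric:
  fixes q :: real
  assumes "0 \<le> q" "q < 1"
  shows "summable (\<lambda>k. (real k)\<^sup>2 * q ^ k)"
proof -
  have 1: "summable (\<lambda>n. diffs (\<lambda>_. 1) n * x ^ n)" if "norm x < 1" for x :: real
    by (rule termdiff_converges[OF that]) (simp add: summable_geometric)
  have "summable (\<lambda>n. diffs (diffs (\<lambda>_. 1)) n * q ^ n)"
    by (rule termdiff_converges[where K = 1]) (use assms 1 in auto)
  then show ?thesis
  proof (rule summable_comparison_test'[where N = 0])
    fix n
    have "(real n)\<^sup>2 \<le> diffs (diffs (\<lambda>_. 1)) n"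
      by (simp add: diffs_def power2_eq_square algebra_simps)
    then show "norm ((real n)\<^sup>2 * q ^ n) \<le> diffs (diffs (\<lambda>_. 1)) n * q ^ n"
      using assms by (simp add: mult_right_mono)
  qed
qed

lemma first_hit_in:
  "\<exists>k. \<omega> (fst z, snd z + int k) \<in> B \<Longrightarrow> \<omega> (fst z, snd z + int (first_hit B \<omega> z)) \<in> B"
  unfolding first_hit_def by (rule LeastI_ex)

text \<open>Climb to the cheap edge, cross it and return: the distance is paid twice.\<close>

lemma directed_time_Suc_le_first_hit:
  assumes "\<exists>k. \<omega> (int n, 0 + int k) \<in> {-K..K}"
  shows "directed_time \<omega> (Suc n) 0 0 \<le> directed_time \<omega> n 0 0 + (K + 2 * real (first_hit {-K..K} \<omega> (int n, 0)))"
proof -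
  let ?f = "first_hit {-K..K} \<omega> (int n, 0)"
  have "\<omega> (int n, int ?f) \<in> {-K..K}"
    using first_hit_in[of \<omega> "(int n, 0)" "{-K..K}"] assms by simp
  then have "\<bar>\<omega> (int n, int ?f)\<bar> \<le> K" by auto
  then show ?thesis
    using directed_time_Suc_le[of \<omega> n 0 0 "int ?f"] directed_time_Lipschitz[of \<omega> n 0 "int ?f" 0] by simp
qed

definition column :: "nat \<Rightarrow> (int \<times> int) set" where
  "column k = {z. fst z = int k}"

section \<open>Moments and variance under independent weights\<close>

locale fpp =
  fixes G :: "real measure"
  assumes prob_G: "prob_space G"
    and sets_G [measurable_cong]: "sets G = sets borel"
    and nonneg_G: "measure G {0..} = 1"
begin

sublocale G: prob_space G
  by (rule prob_G)

sublocale iid_product G "env G"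
  by unfold_locales (simp_all add: prob_G env_def)

lemma space_G: "space G = UNIV"
  using sets_eq_imp_space_eq[OF sets_G] by simp

lemma space_env: "space (env G) = UNIV"
  by (simp add: env_def space_PiM space_G)

lemma weight_measurable [measurable]: "(\<lambda>\<omega>. \<omega> z) \<in> borel_measurable (env G)"
  using component_measurable[of z] by (simp add: measurable_cong_sets[OF refl sets_G])

lemma directed_time_measurable [measurable]:
  "(\<lambda>\<omega>. directed_time \<omega> n a b) \<in> borel_measurable (env G)"
proof (induction n arbitrary: b)
  case (Suc n)
  show ?case
    unfolding directed_time.simps(2)
    by (rule borel_measurable_cINF_real) (use Suc in \<open>auto intro!: borel_measurable_add\<close>)
qed simp

lemma shift_measurable: "shift_env n c \<in> env G \<rightarrow>\<^sub>M env G"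
  unfolding shift_env_def[abs_def] env_def
  by (intro measurable_abs_UNIV measurable_component_singleton UNIV_I)

lemma distr_shift: "distr (env G) (env G) (shift_env n c) = env G"
proof -
  have "inj (\<lambda>z :: int \<times> int. (fst z + int n, snd z + c))"
    by (auto simp: inj_on_def prod_eq_iff)
  then show ?thesis
    using distr_PiM_reindex[of UNIV "\<lambda>_. G" "\<lambda>z. (fst z + int n, snd z + c)" UNIV] prob_G
    by (simp add: env_def restrict_UNIV shift_env_def[abs_def])
qed

lemma prob_all_miss:
  assumes "B \<in> sets borel"
  shows "emeasure (env G) {\<omega>. \<forall>j<k. \<omega> (fst z, snd z + int j) \<notin> B} = ennreal ((1 - measure G B) ^ k)"
proof -
  interpret product_prob_space "\<lambda>_. G" "UNIV :: (int \<times> int) set" ..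
  let ?J = "(\<lambda>j. (fst z, snd z + int j)) ` {..<k}"
  have B: "UNIV - B \<in> sets G" using assms by (simp add: sets_G)
  have "{\<omega>. \<forall>j<k. \<omega> (fst z, snd z + int j) \<notin> B} = {\<omega>\<in>space (env G). \<forall>i\<in>?J. \<omega> i \<in> UNIV - B}"
    by (auto simp: space_env)
  then have "emeasure (env G) {\<omega>. \<forall>j<k. \<omega> (fst z, snd z + int j) \<notin> B} = (\<Prod>i\<in>?J. emeasure G (UNIV - B))"
    using emeasure_PiM_Collect[of ?J "\<lambda>_. UNIV - B"] B by (simp add: env_def)
  also have "\<dots> = emeasure G (UNIV - B) ^ k"
    by (subst prod_constant, subst card_image) (auto simp: inj_on_def)
  also have "emeasure G (UNIV - B) = ennreal (1 - measure G B)"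
    using G.prob_compl[of B] assms by (simp add: G.emeasure_eq_measure sets_G space_G)
  finally show ?thesis by (simp add: ennreal_power)
qed

lemma miss_measurable [measurable]:
  assumes [measurable]: "B \<in> sets borel"
  shows "{\<omega>. \<forall>j<k. \<omega> (fst z, snd z + int j) \<notin> B} \<in> sets (env G)"
proof -
  have "{\<omega> \<in> space (env G). \<forall>j<k. \<omega> (fst z, snd z + int j) \<notin> B} \<in> sets (env G)"
    by measurable
  then show ?thesis by (simp add: space_env)
qed

lemma AE_hit:
  assumes B[measurable]: "B \<in> sets borel" and p: "measure G B > 0"
  shows "AE \<omega> in env G. \<forall>z. \<exists>k. \<omega> (fst z, snd z + int k) \<in> B"
  unfolding AE_all_countable
proof
  fix z :: "int \<times> int"
  let ?N = "\<lambda>k. {\<omega>. \<forall>j<k. \<omega> (fst z, snd z + int j) \<notin> B}"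
  have "(\<lambda>k. (1 - measure G B) ^ k) \<longlonglongrightarrow> 0"
    using p G.prob_le_1[of B] by (intro LIMSEQ_power_zero) auto
  moreover have "prob (\<Inter>k. ?N k) \<le> (1 - measure G B) ^ k" for k
  proof -
    have "prob (\<Inter>k. ?N k) \<le> prob (?N k)"
      by (rule finite_measure_mono) auto
    also have "\<dots> = (1 - measure G B) ^ k"
      using prob_all_miss[OF B, of k z] G.prob_le_1[of B] by (simp add: measure_def)
    finally show ?thesis .
  qed
  ultimately have "prob (\<Inter>k. ?N k) \<le> 0"
    by (intro LIMSEQ_le_const) auto
  then have "emeasure (env G) (\<Inter>k. ?N k) = 0"
    by (simp add: emeasure_eq_measure measure_le_0_iff)
  then show "AE \<omega> in env G. \<exists>k. \<omega> (fst z, snd z + int k) \<in> B"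
    by (intro AE_I[of _ _ "\<Inter>k. ?N k"]) auto
qed

lemma first_hit_measurable [measurable]:
  assumes [measurable]: "B \<in> sets borel"
  shows "(\<lambda>\<omega>. first_hit B \<omega> z) \<in> env G \<rightarrow>\<^sub>M count_space UNIV"
  unfolding first_hit_def by measurable

lemma real_first_hit_measurable [measurable]:
  assumes "B \<in> sets borel"
  shows "(\<lambda>\<omega>. real (first_hit B \<omega> z)) \<in> borel_measurable (env G)"
  by (rule measurable_compose[OF first_hit_measurable[OF assms]]) simp

text \<open>If the first hit is at \<open>m\<close>, the first \<open>m\<close> trials miss, so its
  square is one term of the series of squares weighted by miss events. \<open>not_less_Least\<close>
  gives this even where there is no hit, so no null set intervenes.\<close>

lemma first_hit_second_moment:
  assumes B[measurable]: "B \<in> sets borel" and p: "measure G B > 0"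
  shows "(\<integral>\<^sup>+\<omega>. ennreal ((real (first_hit B \<omega> z))\<^sup>2) \<partial>env G)
    \<le> ennreal (\<Sum>k. (real k)\<^sup>2 * (1 - measure G B) ^ k)"
proof -
  let ?N = "\<lambda>k. {\<omega>. \<forall>j<k. \<omega> (fst z, snd z + int j) \<notin> B}"
  have "ennreal ((real (first_hit B \<omega> z))\<^sup>2) \<le> (\<Sum>k. ennreal ((real k)\<^sup>2) * indicator (?N k) \<omega>)" for \<omega>
  proof -
    define m where "m = first_hit B \<omega> z"
    have "\<omega> \<in> ?N m"
      unfolding m_def first_hit_def using not_less_Least by blast
    then have "ennreal ((real m)\<^sup>2) = (\<Sum>k\<in>{m}. ennreal ((real k)\<^sup>2) * indicator (?N k) \<omega>)"
      by simp
    also have "\<dots> \<le> (\<Sum>k. ennreal ((real k)\<^sup>2) * indicator (?N k) \<omega>)"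
      by (rule sum_le_suminf) auto
    finally show ?thesis by (simp add: m_def)
  qed
  then have "(\<integral>\<^sup>+\<omega>. ennreal ((real (first_hit B \<omega> z))\<^sup>2) \<partial>env G)
      \<le> (\<integral>\<^sup>+\<omega>. (\<Sum>k. ennreal ((real k)\<^sup>2) * indicator (?N k) \<omega>) \<partial>env G)"
    by (intro nn_integral_mono)
  also have "\<dots> = (\<Sum>k. \<integral>\<^sup>+\<omega>. ennreal ((real k)\<^sup>2) * indicator (?N k) \<omega> \<partial>env G)"
    by (rule nn_integral_suminf) simp
  also have "\<dots> = (\<Sum>k. ennreal ((real k)\<^sup>2 * (1 - measure G B) ^ k))"
    by (subst nn_integral_cmult_indicator)
       (simp_all add: prob_all_miss ennreal_mult G.prob_le_1)
  also have "\<dots> = ennreal (\<Sum>k. (real k)\<^sup>2 * (1 - measure G B) ^ k)"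
    by (rule suminf_ennreal2) (use p G.prob_le_1[of B] in \<open>auto intro!: summable_square_geometric\<close>)
  finally show ?thesis .
qed

text \<open>Detour costs are affine in \<open>first_hit\<close>. Uniformity in \<open>z\<close>
  matters because a detour starts at a height that depends on the other columns.\<close>

lemma first_hit_affine_moment:
  assumes B[measurable]: "B \<in> sets borel" and "measure G B > 0"
  obtains C where "0 \<le> C" "\<And>z. (\<integral>\<^sup>+\<omega>. ennreal ((c + d * real (first_hit B \<omega> z))\<^sup>2) \<partial>env G) \<le> ennreal C"
proof -
  define C where "C = (\<Sum>k. (real k)\<^sup>2 * (1 - measure G B) ^ k)"
  have C: "0 \<le> C"
    unfolding C_def using assms G.prob_le_1[of B] by (intro suminf_nonneg summable_square_geometric) auto
  have "(\<integral>\<^sup>+\<omega>. ennreal ((c + d * real (first_hit B \<omega> z))\<^sup>2) \<partial>env G) \<le> ennreal (2 * c\<^sup>2 + 2 * d\<^sup>2 * C)" for z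
  proof -
    have "(c + d * real (first_hit B \<omega> z))\<^sup>2 \<le> 2 * c\<^sup>2 + 2 * d\<^sup>2 * (real (first_hit B \<omega> z))\<^sup>2" for \<omega>
      using sum_squares_bound[of c "d * real (first_hit B \<omega> z)"]
      by (simp add: power2_sum power_mult_distrib)
    then have "(\<integral>\<^sup>+\<omega>. ennreal ((c + d * real (first_hit B \<omega> z))\<^sup>2) \<partial>env G)
      \<le> (\<integral>\<^sup>+\<omega>. ennreal (2 * c\<^sup>2) + ennreal (2 * d\<^sup>2) * ennreal ((real (first_hit B \<omega> z))\<^sup>2) \<partial>env G)"
      by (intro nn_integral_mono) (simp add: ennreal_plus[symmetric] ennreal_mult[symmetric] ennreal_leI del: ennreal_plus)
    also have "\<dots> = ennreal (2 * c\<^sup>2) + ennreal (2 * d\<^sup>2) * (\<integral>\<^sup>+\<omega>. ennreal ((real (first_hit B \<omega> z))\<^sup>2) \<partial>env G)"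
      by (subst nn_integral_add) (auto simp: nn_integral_cmult emeasure_space_1)
    also have "\<dots> \<le> ennreal (2 * c\<^sup>2) + ennreal (2 * d\<^sup>2) * ennreal C"
      unfolding C_def by (intro add_left_mono mult_left_mono first_hit_second_moment assms) simp
    finally show ?thesis
      using C by (simp add: ennreal_plus[symmetric] ennreal_mult[symmetric] del: ennreal_plus)
  qed
  with C show thesis by (intro that[of "2 * c\<^sup>2 + 2 * d\<^sup>2 * C"]) auto
qed

text \<open>The intervals \<open>{-n..n}\<close> exhaust the line. This positive mass is what
  replaces a moment condition on the weights.\<close>

lemma bounded_weight_set:
  obtains K where "0 \<le> K" "measure G {-K..K} > 0"
proof -
  have "\<exists>n :: nat. measure G {- real n..real n} > 0"
  proof (rule ccontr)
    assume "\<not> ?thesis"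
    then have "measure G {- real n..real n} = 0" for n
      using measure_nonneg[of G "{- real n..real n}"] by (metis less_eq_real_def)
    then have "{- real n..real n} \<in> null_sets G" for n
      by (simp add: null_sets_def G.emeasure_eq_measure sets_G)
    then have "(\<Union>n. {- real n..real n}) \<in> null_sets G"
      by (rule null_sets_UN)
    moreover have "(\<Union>n. {- real n..real n}) = UNIV"
    proof -
      have "\<exists>n. x \<in> {- real n..real n}" for x
        using real_arch_simple[of "\<bar>x\<bar>"] by (auto simp: abs_le_iff) (metis minus_le_iff)
      then show ?thesis by blast
    qed
    ultimately have "emeasure G UNIV = 0" by auto
    then show False using G.emeasure_space_1 by (simp add: space_G)
  qed
  then show thesis using that by (metis of_nat_0_le_iff)
qed

text \<open>Induct along height 0, where each new column costs one detour with finite second moment.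
  Other heights follow from the Lipschitz bound.\<close>

lemma directed_time_square_integrable:
  "integrable (env G) (\<lambda>\<omega>. (directed_time \<omega> n 0 b)\<^sup>2)"
proof -
  obtain K where K: "0 \<le> K" "measure G {-K..K} > 0" by (rule bounded_weight_set)
  have B[measurable]: "{-K..K} \<in> sets borel" by simp
  obtain C where C: "\<And>z. (\<integral>\<^sup>+\<omega>. ennreal ((K + 2 * real (first_hit {-K..K} \<omega> z))\<^sup>2) \<partial>env G) \<le> ennreal C"
    using first_hit_affine_moment[OF B K(2), of K 2] by blast
  have hit: "integrable (env G) (\<lambda>\<omega>. (K + 2 * real (first_hit {-K..K} \<omega> z))\<^sup>2)" for z
    using le_less_trans[OF C ennreal_less_top] by (intro integrableI_nonneg) auto
  have 0: "integrable (env G) (\<lambda>\<omega>. (directed_time \<omega> n 0 0)\<^sup>2)" for n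
  proof (induction n)
    case (Suc n)
    show ?case
    proof (rule Bochner_Integration.integrable_bound)
      show "integrable (env G) (\<lambda>\<omega>. 2 * (directed_time \<omega> n 0 0)\<^sup>2
          + 2 * (K + 2 * real (first_hit {-K..K} \<omega> (int n, 0)))\<^sup>2)"
        using Suc hit by simp
      show "AE \<omega> in env G. norm ((directed_time \<omega> (Suc n) 0 0)\<^sup>2) \<le> norm (2 * (directed_time \<omega> n 0 0)\<^sup>2
          + 2 * (K + 2 * real (first_hit {-K..K} \<omega> (int n, 0)))\<^sup>2)"
        using AE_hit[OF B K(2)]
      proof eventually_elim
        case (elim \<omega>)
        define x where "x = directed_time \<omega> n 0 0"
        define y where "y = K + 2 * real (first_hit {-K..K} \<omega> (int n, 0))"
        have "\<exists>k. \<omega> (int n, 0 + int k) \<in> {-K..K}" using spec[OF elim, of "(int n, 0)"] by simp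
        from directed_time_Suc_le_first_hit[OF this]
        have "(directed_time \<omega> (Suc n) 0 0)\<^sup>2 \<le> (x + y)\<^sup>2"
          unfolding x_def y_def by (intro power_mono directed_time_nonneg)
        also have "\<dots> \<le> 2 * x\<^sup>2 + 2 * y\<^sup>2"
          using sum_squares_bound[of x y] by (simp add: power2_sum)
        finally show ?case by (simp add: x_def y_def)
      qed
    qed simp
  qed simp
  show ?thesis
  proof (rule Bochner_Integration.integrable_bound)
    show "integrable (env G) (\<lambda>\<omega>. 2 * (directed_time \<omega> n 0 0)\<^sup>2 + 2 * (real_of_int \<bar>b\<bar>)\<^sup>2)"
      using 0 by simp
    have "norm ((directed_time \<omega> n 0 b)\<^sup>2) \<le> norm (2 * (directed_time \<omega> n 0 0)\<^sup>2 + 2 * (real_of_int \<bar>b\<bar>)\<^sup>2)" for \<omega>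
    proof -
      have "(directed_time \<omega> n 0 b)\<^sup>2 \<le> (directed_time \<omega> n 0 0 + real_of_int \<bar>b\<bar>)\<^sup>2"
        using directed_time_Lipschitz[of \<omega> n 0 b 0] by (intro power_mono directed_time_nonneg) simp
      also have "\<dots> \<le> 2 * (directed_time \<omega> n 0 0)\<^sup>2 + 2 * (real_of_int \<bar>b\<bar>)\<^sup>2"
        using sum_squares_bound[of "directed_time \<omega> n 0 0" "real_of_int \<bar>b\<bar>"] by (simp add: power2_sum)
      finally show ?thesis by simp
    qed
    then show "AE \<omega> in env G. norm ((directed_time \<omega> n 0 b)\<^sup>2)
        \<le> norm (2 * (directed_time \<omega> n 0 0)\<^sup>2 + 2 * (real_of_int \<bar>b\<bar>)\<^sup>2)" by simp
  qed simp
qed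

lemma directed_time_integrable: "integrable (env G) (\<lambda>\<omega>. directed_time \<omega> n 0 b)"
  by (rule square_integrable_imp_integrable[OF _ directed_time_square_integrable]) simp

lemma directed_time_variance:
  obtains C where "0 \<le> C" "\<And>n b. variance (\<lambda>\<omega>. directed_time \<omega> n 0 b) \<le> C * real n"
proof -
  obtain K where K: "0 \<le> K" "measure G {-K..K} > 0" by (rule bounded_weight_set)
  have B[measurable]: "{-K..K} \<in> sets borel" by simp
  let ?f = "first_hit {-K..K}"
  \<comment> \<open>\<open>K\<close> bounds the weight of the edge used by the detour, and the extra
    1 is the slack \<epsilon> = 1 of \<open>directed_time_resample\<close>.\<close>
  obtain C where C: "0 \<le> C" "\<And>z. (\<integral>\<^sup>+\<omega>. ennreal (((1 + K) + 2 * real (?f \<omega> z))\<^sup>2) \<partial>env G) \<le> ennreal C"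
    using first_hit_affine_moment[OF B K(2), of "1 + K" 2] by blast
  have "variance (\<lambda>\<omega>. directed_time \<omega> n 0 b) \<le> C * real n" for n b
  proof -
    let ?X = "\<lambda>\<omega>. directed_time \<omega> n 0 b" and ?P = "env G \<Otimes>\<^sub>M env G"
    \<comment> \<open>Only increases are bounded directly. The height \<open>y\<close> of the detour
      is determined by the first copy, so it is fixed in the inner integral over the independent
      second copy.\<close>
    have one: "(\<integral>\<^sup>+p. ennreal ((max 0 (?X (fst (swap_on (column k) p)) - ?X (fst p)))\<^sup>2) \<partial>?P) \<le> ennreal C"
      if k: "k < n" for k
    proof -
      have "(\<integral>\<^sup>+\<omega>'. ennreal ((max 0 (?X (fst (swap_on (column k) (\<omega>, \<omega>'))) - ?X \<omega>))\<^sup>2) \<partial>env G) \<le> ennreal C" for \<omega>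
      proof -
        obtain y where y: "\<And>\<omega>' j. \<forall>x z. x \<noteq> int k \<longrightarrow> \<omega>' (x, z) = \<omega> (x, z) \<Longrightarrow>
            ?X \<omega>' \<le> ?X \<omega> + 1 + \<bar>\<omega>' (int k, y + j)\<bar> + 2 * real_of_int \<bar>j\<bar>"
          using directed_time_resample[OF k zero_less_one, of \<omega> 0 b] by blast
        have "(\<integral>\<^sup>+\<omega>'. ennreal ((max 0 (?X (fst (swap_on (column k) (\<omega>, \<omega>'))) - ?X \<omega>))\<^sup>2) \<partial>env G)
          \<le> (\<integral>\<^sup>+\<omega>'. ennreal (((1 + K) + 2 * real (?f \<omega>' (int k, y)))\<^sup>2) \<partial>env G)"
        proof (rule nn_integral_mono_AE)
          show "AE \<omega>' in env G. ennreal ((max 0 (?X (fst (swap_on (column k) (\<omega>, \<omega>'))) - ?X \<omega>))\<^sup>2)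
              \<le> ennreal (((1 + K) + 2 * real (?f \<omega>' (int k, y)))\<^sup>2)"
            using AE_hit[OF B K(2)]
          proof eventually_elim
            case (elim \<omega>')
            define m where "m = ?f \<omega>' (int k, y)"
            define \<eta> where "\<eta> = fst (swap_on (column k) (\<omega>, \<omega>'))"
            have "\<omega>' (int k, y + int m) \<in> {-K..K}"
              using first_hit_in[of \<omega>' "(int k, y)" "{-K..K}"] elim unfolding m_def by auto
            moreover have "\<eta> (int k, y + int m) = \<omega>' (int k, y + int m)"
              by (simp add: \<eta>_def swap_on_def column_def)
            moreover have "\<forall>x z. x \<noteq> int k \<longrightarrow> \<eta> (x, z) = \<omega> (x, z)"
              by (simp add: \<eta>_def swap_on_def column_def)
            ultimately have "?X \<eta> - ?X \<omega> \<le> (1 + K) + 2 * real m"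
              using y[of \<eta> "int m"] by (simp add: abs_le_iff) linarith
            then show ?case
              unfolding \<eta>_def[symmetric] m_def[symmetric] using K(1)
              by (intro ennreal_leI power_mono) auto
          qed
        qed
        also have "\<dots> \<le> ennreal C" by (rule C)
        finally show ?thesis .
      qed
      then have "(\<integral>\<^sup>+\<omega>. \<integral>\<^sup>+\<omega>'. ennreal ((max 0 (?X (fst (swap_on (column k) (\<omega>, \<omega>'))) - ?X \<omega>))\<^sup>2) \<partial>env G \<partial>env G)
          \<le> (\<integral>\<^sup>+\<omega>. ennreal C \<partial>env G)"
        by (intro nn_integral_mono)
      then show ?thesis
        by (subst nn_integral_fst[symmetric]) (simp_all add: emeasure_space_1)
    qed
    \<comment> \<open>A decrease is an increase with the copies swapped. The resulting factor 2
      cancels the half in \<open>Efron_Stein\<close>.\<close>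
    have two: "(\<integral>p. (?X (fst p) - ?X (fst (swap_on (column k) p)))\<^sup>2 \<partial>?P) \<le> 2 * C" if k: "k < n" for k
    proof -
      let ?g = "\<lambda>p. ennreal ((max 0 (?X (fst (swap_on (column k) p)) - ?X (fst p)))\<^sup>2)"
      have g[measurable]: "?g \<in> borel_measurable ?P" by simp
      have "ennreal ((?X (fst p) - ?X (fst (swap_on (column k) p)))\<^sup>2)
          = ?g p + ?g (swap_on (column k) p)" for p
      proof -
        have "(x - y)\<^sup>2 = (max 0 (y - x))\<^sup>2 + (max 0 (x - y))\<^sup>2" for x y :: real
          by (auto simp: max_def power2_commute)
        then show ?thesis
          by (simp add: swap_on_swap_on ennreal_plus[symmetric] del: ennreal_plus)
      qed
      then have "(\<integral>\<^sup>+p. ennreal ((?X (fst p) - ?X (fst (swap_on (column k) p)))\<^sup>2) \<partial>?P)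
          = (\<integral>\<^sup>+p. ?g p \<partial>?P) + (\<integral>\<^sup>+p. ?g (swap_on (column k) p) \<partial>?P)"
        by (simp only:) (rule nn_integral_add; measurable)
      also have "\<dots> = (\<integral>\<^sup>+p. ?g p \<partial>?P) + (\<integral>\<^sup>+p. ?g p \<partial>?P)"
        by (simp only: nn_integral_swap[OF g])
      also have "\<dots> \<le> ennreal C + ennreal C"
        by (intro add_mono one k)
      also have "\<dots> = ennreal (2 * C)"
        using C(1) by (simp add: ennreal_plus[symmetric] del: ennreal_plus)
      finally show ?thesis
        using C(1) by (subst integral_eq_nn_integral) (auto intro!: enn2real_leI)
    qed
    have "variance ?X \<le> (\<Sum>k<n. \<integral>p. (?X (fst p) - ?X (fst (swap_on (column k) p)))\<^sup>2 \<partial>?P) / 2"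
    proof (rule Efron_Stein)
      show "?X \<omega> = ?X \<omega>'" if "\<And>i. i \<in> (\<Union>k<n. column k) \<Longrightarrow> \<omega> i = \<omega>' i" for \<omega> \<omega>'
      proof (rule directed_time_cong)
        fix x y :: int assume "0 \<le> x" "x < int n"
        then show "\<omega> (x, y) = \<omega>' (x, y)"
          by (intro that) (auto simp: column_def intro!: bexI[of _ "nat x"])
      qed
    qed (auto simp: disjoint_family_on_def column_def directed_time_square_integrable)
    also have "\<dots> \<le> (\<Sum>k<n. 2 * C) / 2"
      by (intro divide_right_mono sum_mono two) auto
    finally show ?thesis by (simp add: mult.commute)
  qed
  with C(1) show thesis by (rule that)
qed

end

section \<open>The time constant\<close>

text \<open>Adding 1 to the sequence absorbs the defect; what remains is Fekete's argument.\<close>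

lemma almost_subadditive_convergent:
  fixes a :: "nat \<Rightarrow> real"
  assumes nonneg: "\<And>n. 0 \<le> a n" and sub: "\<And>n m. a (n + m) \<le> a n + a m + 1"
  shows "convergent (\<lambda>n. a n / real n)"
proof -
  define u where "u n = a n + 1" for n
  have u_pos: "0 \<le> u n" for n using nonneg[of n] by (simp add: u_def)
  have u_sub: "u (n + m) \<le> u n + u m" for n m using sub[of n m] by (simp add: u_def)
  have u_mult: "u (q * k + r) \<le> real q * u k + u r" for q k r
  proof (induction q)
    case (Suc q)
    then show ?case using u_sub[of k "q * k + r"] by (simp add: algebra_simps)
  qed simp
  define L where "L = (INF n\<in>{1..}. u n / real n)"
  have bdd: "bdd_below ((\<lambda>n. u n / real n) ` {1..})"
    by (rule bdd_belowI[of _ 0]) (auto simp: u_pos)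
  have "(\<lambda>n. u n / real n) \<longlonglongrightarrow> L"
  proof (rule LIMSEQ_I)
    fix \<epsilon> :: real assume \<epsilon>: "0 < \<epsilon>"
    then have "\<exists>y\<in>(\<lambda>n. u n / real n) ` {1..}. y < L + \<epsilon> / 2"
      unfolding L_def by (intro cInf_lessD) auto
    then obtain k where k: "1 \<le> k" "u k / real k < L + \<epsilon> / 2"
      by auto
    \<comment> \<open>Bounds the contribution of the remainder when \<open>n\<close> is divided by
      \<open>k\<close>, independently of \<open>n\<close>.\<close>
    define D where "D = (\<Sum>r<k. u r)"
    have D: "u r \<le> D" if "r < k" for r
      unfolding D_def using that u_pos by (intro member_le_sum) auto
    obtain N where N: "2 * D / \<epsilon> < real N" using reals_Archimedean2 by blast
    have "norm (u n / real n - L) < \<epsilon>" if n: "n \<ge> max N 1" for n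
    proof -
      have n0: "0 < real n" using n by simp
      have "L \<le> u n / real n"
        unfolding L_def by (rule cINF_lower[OF bdd]) (use n in auto)
      moreover have "u n / real n \<le> u k / real k + D / real n"
      proof -
        have "u n \<le> real (n div k) * u k + u (n mod k)"
          using u_mult[of "n div k" k "n mod k"] by simp
        moreover have "real (n div k) \<le> real n / real k"
        proof -
          have "real (n div k * k) \<le> real n" by (simp only: of_nat_le_iff div_times_less_eq_dividend)
          then show ?thesis using k by (simp add: le_divide_eq)
        qed
        then have "real (n div k) * u k + u (n mod k) \<le> (real n / real k) * u k + D"
          using k by (intro add_mono mult_right_mono D u_pos) auto
        ultimately have "u n \<le> (real n / real k) * u k + D" by linarith
        then show ?thesis using n0 by (simp add: field_simps)
      qed
      moreover have "D / real n < \<epsilon> / 2"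
      proof -
        have "2 * D / \<epsilon> < real n" using N n by linarith
        then show ?thesis using \<epsilon> n0 by (simp add: field_simps)
      qed
      ultimately show ?thesis using k(2) unfolding real_norm_def by linarith
    qed
    then show "\<exists>no. \<forall>n\<ge>no. norm (u n / real n - L) < \<epsilon>" by blast
  qed
  moreover have "(\<lambda>n. 1 / real n) \<longlonglongrightarrow> 0" by (rule lim_1_over_n)
  ultimately have "(\<lambda>n. u n / real n - 1 / real n) \<longlonglongrightarrow> L - 0" by (rule tendsto_diff)
  moreover have "u n / real n - 1 / real n = a n / real n" for n
    by (simp add: u_def diff_divide_distrib[symmetric])
  ultimately show ?thesis by (auto simp: convergent_def)
qed

text \<open>Enclose \<open>n\<close> between consecutive squares. Their ratio tends to 1, and the
  almost monotonicity of \<open>t\<close> compares \<open>t n\<close> with its values at both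
  squares.\<close>

lemma tendsto_from_squares:
  fixes t :: "nat \<Rightarrow> real"
  assumes t: "\<And>n m. n \<le> m \<Longrightarrow> t n \<le> t m + v * (real m - real n) + 1" and v: "0 \<le> v"
    and lim: "(\<lambda>k. t (k\<^sup>2) / real (k\<^sup>2)) \<longlonglongrightarrow> c"
  shows "(\<lambda>n. t n / real n) \<longlonglongrightarrow> c"
proof -
  define s where "s n = floor_sqrt n" for n
  \<comment> \<open>Since \<open>sqrt n\<close> lies between \<open>s n\<close> and
    \<open>s n + 1\<close>, the quotients of the two squares by \<open>n\<close> are controlled by
    the squares of \<open>1 + w n\<close> and \<open>1 - w n\<close>.\<close>
  define w where "w n = 1 / sqrt (real n)" for n
  define x where "x k = t (k\<^sup>2) / real (k\<^sup>2)" for k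
  have w0: "w \<longlonglongrightarrow> 0"
    unfolding w_def by (intro tendsto_divide_0[OF tendsto_const] filterlim_at_top_imp_at_infinity
      filterlim_compose[OF sqrt_at_top] filterlim_real_sequentially)
  have s_top: "filterlim s at_top sequentially"
    unfolding filterlim_at_top
  proof
    fix Z show "eventually (\<lambda>n. Z \<le> s n) sequentially"
      unfolding eventually_sequentially s_def
      by (intro exI[of _ "Z\<^sup>2"]) (auto intro: le_floor_sqrtI)
  qed
  have x1: "(\<lambda>n. x (s n)) \<longlonglongrightarrow> c"
    using filterlim_compose[OF lim s_top] by (simp add: x_def)
  have x2: "(\<lambda>n. x (Suc (s n))) \<longlonglongrightarrow> c"
    using filterlim_compose[OF lim filterlim_compose[OF filterlim_Suc s_top]] by (simp add: x_def)
  have sn: "real (s n) \<le> sqrt (real n)" "sqrt (real n) \<le> real (s n) + 1" for n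
  proof -
    show "real (s n) \<le> sqrt (real n)"
      unfolding s_def by (intro real_le_rsqrt) (metis floor_sqrt_power2_le of_nat_le_iff of_nat_power)
    have "n \<le> (s n + 1)\<^sup>2" unfolding s_def using Suc_floor_sqrt_power2_gt[of n] by simp
    then have "real n \<le> (real (s n) + 1)\<^sup>2" by (metis of_nat_1 of_nat_add of_nat_le_iff of_nat_power)
    then show "sqrt (real n) \<le> real (s n) + 1" by (intro real_le_lsqrt) auto
  qed
  have pos: "eventually (\<lambda>n. 0 < n) sequentially" by (rule eventually_gt_at_top)
  have sq: "sqrt (real n) > 0" "real n = (sqrt (real n))\<^sup>2" if "0 < n" for n
    using that by auto
  have r: "(\<lambda>n. real ((Suc (s n))\<^sup>2) / real n) \<longlonglongrightarrow> 1"
  proof (rule tendsto_sandwich)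
    show "(\<lambda>n. 1) \<longlonglongrightarrow> (1::real)" by simp
    show "(\<lambda>n. (1 + w n)\<^sup>2) \<longlonglongrightarrow> 1"
      using tendsto_power[OF tendsto_add[OF tendsto_const w0], of 1 2] by simp
    show "eventually (\<lambda>n. 1 \<le> real ((Suc (s n))\<^sup>2) / real n) sequentially"
      using pos
    proof eventually_elim
      case (elim n)
      have "real n \<le> real ((Suc (s n))\<^sup>2)"
        using Suc_floor_sqrt_power2_gt[of n] by (simp only: s_def of_nat_le_iff)
      then show ?case using elim by simp
    qed
    show "eventually (\<lambda>n. real ((Suc (s n))\<^sup>2) / real n \<le> (1 + w n)\<^sup>2) sequentially"
      using pos
    proof eventually_elim
      case (elim n)
      have "real ((Suc (s n))\<^sup>2) \<le> (sqrt (real n) + 1)\<^sup>2"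
        using sn(1)[of n] by (simp add: add.commute power_mono)
      also have "\<dots> = (1 + w n)\<^sup>2 * real n"
        using sq[OF elim] unfolding w_def by (simp add: field_simps power2_eq_square)
      finally show ?case using elim by (simp add: divide_le_eq)
    qed
  qed
  have l: "(\<lambda>n. real ((s n)\<^sup>2) / real n) \<longlonglongrightarrow> 1"
  proof (rule tendsto_sandwich)
    show "(\<lambda>n. (1 - w n)\<^sup>2) \<longlonglongrightarrow> 1"
      using tendsto_power[OF tendsto_diff[OF tendsto_const w0], of 1 2] by simp
    show "(\<lambda>n. 1) \<longlonglongrightarrow> (1::real)" by simp
    show "eventually (\<lambda>n. real ((s n)\<^sup>2) / real n \<le> 1) sequentially"
      using pos
    proof eventually_elim
      case (elim n)
      have "real ((s n)\<^sup>2) \<le> real n"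
        using floor_sqrt_power2_le[of n] by (simp only: s_def of_nat_le_iff)
      then show ?case using elim by simp
    qed
    show "eventually (\<lambda>n. (1 - w n)\<^sup>2 \<le> real ((s n)\<^sup>2) / real n) sequentially"
      using pos
    proof eventually_elim
      case (elim n)
      have "1 \<le> sqrt (real n)" using elim by simp
      then have "(sqrt (real n) - 1)\<^sup>2 \<le> real ((s n)\<^sup>2)"
        using sn(2)[of n] by (simp add: power_mono)
      moreover have "(sqrt (real n) - 1)\<^sup>2 = (1 - w n)\<^sup>2 * real n"
        using sq[OF elim] unfolding w_def by (simp add: field_simps power2_eq_square)
      ultimately show ?case using elim by (simp add: le_divide_eq)
    qed
  qed
  \<comment> \<open>The error of passing from \<open>n\<close> to a neighbouring square: the defect
    of monotonicity over the whole gap between the squares, divided by \<open>n\<close>.\<close>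
  define e where "e n = v * (real ((Suc (s n))\<^sup>2) / real n - real ((s n)\<^sup>2) / real n) + 1 / real n" for n
  have e: "e \<longlonglongrightarrow> 0"
    using tendsto_add[OF tendsto_mult[OF tendsto_const tendsto_diff[OF r l]] lim_1_over_n, of v]
    unfolding e_def by simp
  show ?thesis
  proof (rule tendsto_sandwich)
    show "(\<lambda>n. x (s n) * (real ((s n)\<^sup>2) / real n) - e n) \<longlonglongrightarrow> c"
      using tendsto_diff[OF tendsto_mult[OF x1 l] e] by simp
    show "(\<lambda>n. x (Suc (s n)) * (real ((Suc (s n))\<^sup>2) / real n) + e n) \<longlonglongrightarrow> c"
      using tendsto_add[OF tendsto_mult[OF x2 r] e] by simp
    have key: "x (s n) * (real ((s n)\<^sup>2) / real n) - e n \<le> t n / real n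
        \<and> t n / real n \<le> x (Suc (s n)) * (real ((Suc (s n))\<^sup>2) / real n) + e n" if n: "0 < n" for n
    proof -
      define A B where "A = (s n)\<^sup>2" and "B = (Suc (s n))\<^sup>2"
      have A: "A \<le> n" "0 < A" and B: "n \<le> B" "0 < B"
        unfolding A_def B_def s_def using Suc_floor_sqrt_power2_gt[of n] n by auto
      have en: "(y + v * (real B - real A) + 1) / real n = y / real n + e n" for y
        unfolding e_def A_def[symmetric] B_def[symmetric]
        by (simp add: add_divide_distrib diff_divide_distrib right_diff_distrib)
      have "t n \<le> t B + v * (real B - real A) + 1"
        using t[OF B(1)] mult_left_mono[OF _ v, of "real B - real n" "real B - real A"] A by simp
      then have "t n / real n \<le> t B / real n + e n"
        unfolding en[symmetric] by (rule divide_right_mono) simp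
      moreover have "t A \<le> t n + v * (real B - real A) + 1"
        using t[OF A(1)] mult_left_mono[OF _ v, of "real n - real A" "real B - real A"] B by simp
      then have "t A / real n \<le> t n / real n + e n"
        unfolding en[symmetric] by (rule divide_right_mono) simp
      moreover have "x (s n) * (real A / real n) = t A / real n" "x (Suc (s n)) * (real B / real n) = t B / real n"
        using A B by (simp_all add: x_def A_def B_def)
      ultimately show ?thesis
        unfolding A_def[symmetric] B_def[symmetric] by linarith
    qed
    show "eventually (\<lambda>n. x (s n) * (real ((s n)\<^sup>2) / real n) - e n \<le> t n / real n) sequentially"
      using pos by eventually_elim (use key in blast)
    show "eventually (\<lambda>n. t n / real n \<le> x (Suc (s n)) * (real ((Suc (s n))\<^sup>2) / real n) + e n) sequentially"
      using pos by eventually_elim (use key in blast)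
  qed
qed

section \<open>Mean passage times and the almost sure limit\<close>

context fpp
begin

definition mean_time :: "nat \<Rightarrow> int \<Rightarrow> real" where
  "mean_time n b = expectation (\<lambda>\<omega>. directed_time \<omega> n 0 b)"

lemma mean_time_nonneg: "0 \<le> mean_time n b"
  unfolding mean_time_def by (intro Bochner_Integration.integral_nonneg directed_time_nonneg)

lemma mean_time_Lipschitz: "mean_time n b \<le> mean_time n b' + real_of_int \<bar>b - b'\<bar>"
proof -
  have "mean_time n b \<le> expectation (\<lambda>\<omega>. directed_time \<omega> n 0 b' + real_of_int \<bar>b - b'\<bar>)"
    unfolding mean_time_def
    by (intro integral_mono directed_time_Lipschitz Bochner_Integration.integrable_add directed_time_integrable) simp
  then show ?thesis
    by (simp add: mean_time_def directed_time_integrable prob_space)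
qed

lemma mean_time_subadditive: "mean_time (n + m) (c + b) \<le> mean_time n c + mean_time m b"
proof -
  have shifted: "integrable (env G) (\<lambda>\<omega>. directed_time (shift_env n c \<omega>) m 0 b)"
    by (rule integrable_distr[OF shift_measurable]) (simp add: distr_shift directed_time_integrable)
  have "mean_time (n + m) (c + b)
      \<le> expectation (\<lambda>\<omega>. directed_time \<omega> n 0 c + directed_time (shift_env n c \<omega>) m 0 b)"
    unfolding mean_time_def
    by (intro integral_mono directed_time_concat Bochner_Integration.integrable_add directed_time_integrable shifted)
  also have "\<dots> = mean_time n c + expectation (\<lambda>\<omega>. directed_time (shift_env n c \<omega>) m 0 b)"
    unfolding mean_time_def by (intro Bochner_Integration.integral_add directed_time_integrable shifted)
  also have "expectation (\<lambda>\<omega>. directed_time (shift_env n c \<omega>) m 0 b) = mean_time m b"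
    unfolding mean_time_def
    by (subst (2) distr_shift[of n c, symmetric], subst integral_distr[OF shift_measurable]) simp_all
  finally show ?thesis .
qed

definition speed :: "real \<Rightarrow> real" where
  "speed v = lim (\<lambda>n. mean_time n \<lceil>v * real n\<rceil> / real n)"

lemma mean_time_tendsto: "(\<lambda>n. mean_time n \<lceil>v * real n\<rceil> / real n) \<longlonglongrightarrow> speed v"
proof -
  have "convergent (\<lambda>n. mean_time n \<lceil>v * real n\<rceil> / real n)"
  proof (rule almost_subadditive_convergent[OF mean_time_nonneg])
    fix n m
    \<comment> \<open>Rounding the endpoint is the only obstacle to exact subadditivity and the
      source of the defect 1.\<close>
    have "\<bar>\<lceil>v * real (n + m)\<rceil> - (\<lceil>v * real n\<rceil> + \<lceil>v * real m\<rceil>)\<bar> \<le> 1"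
      unfolding of_nat_add distrib_left by linarith
    then have "real_of_int \<bar>\<lceil>v * real (n + m)\<rceil> - (\<lceil>v * real n\<rceil> + \<lceil>v * real m\<rceil>)\<bar> \<le> 1"
      by linarith
    then show "mean_time (n + m) \<lceil>v * real (n + m)\<rceil>
        \<le> mean_time n \<lceil>v * real n\<rceil> + mean_time m \<lceil>v * real m\<rceil> + 1"
      using mean_time_Lipschitz[of "n + m" "\<lceil>v * real (n + m)\<rceil>" "\<lceil>v * real n\<rceil> + \<lceil>v * real m\<rceil>"]
        mean_time_subadditive[of n m "\<lceil>v * real n\<rceil>" "\<lceil>v * real m\<rceil>"] by linarith
  qed
  then show ?thesis unfolding speed_def by (simp add: convergent_LIMSEQ_iff)
qed

text \<open>Linear variance gives the rate \<open>1 / n\<close>, which is not summable over all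
  \<open>n\<close> but is summable along the squares.\<close>

lemma deviation_bound:
  obtains C where "0 \<le> C" "\<And>n b \<delta>. 0 < n \<Longrightarrow> 0 < \<delta> \<Longrightarrow>
    prob {\<omega>. \<bar>directed_time \<omega> n 0 b - mean_time n b\<bar> \<ge> \<delta> * real n} \<le> C / (\<delta>\<^sup>2 * real n)"
proof -
  obtain C where C: "0 \<le> C" "\<And>n b. variance (\<lambda>\<omega>. directed_time \<omega> n 0 b) \<le> C * real n"
    using directed_time_variance by blast
  have "prob {\<omega>. \<bar>directed_time \<omega> n 0 b - mean_time n b\<bar> \<ge> \<delta> * real n} \<le> C / (\<delta>\<^sup>2 * real n)"
    if "0 < n" "0 < \<delta>" for n b \<delta>
  proof -
    have "prob {\<omega>. \<bar>directed_time \<omega> n 0 b - mean_time n b\<bar> \<ge> \<delta> * real n}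
        \<le> variance (\<lambda>\<omega>. directed_time \<omega> n 0 b) / (\<delta> * real n)\<^sup>2"
      using Chebyshev_inequality[of "\<lambda>\<omega>. directed_time \<omega> n 0 b" "\<delta> * real n"] that
        directed_time_square_integrable[of n b]
      by (simp add: space_env mean_time_def)
    also have "\<dots> \<le> C * real n / (\<delta> * real n)\<^sup>2"
      by (intro divide_right_mono C) simp
    also have "\<dots> = C / (\<delta>\<^sup>2 * real n)"
      using that by (simp add: field_simps power2_eq_square)
    finally show ?thesis .
  qed
  with C(1) show thesis by (rule that)
qed

lemma AE_weights:
  assumes "AE x in G. P x"
  shows "AE \<omega> in env G. \<forall>z. P (\<omega> z)"
  unfolding AE_all_countable
proof
  fix z
  have "AE x in distr (env G) G (\<lambda>\<omega>. \<omega> z). P x"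
    using assms by (subst distr_component)
  then show "AE \<omega> in env G. P (\<omega> z)"
    by (rule AE_distrD[OF component_measurable])
qed

lemma AE_nonneg: "AE \<omega> in env G. \<forall>z. 0 \<le> \<omega> z"
proof -
  have "AE x in G. x \<in> {0..}"
    using nonneg_G by (intro G.AE_prob_1)
  then show ?thesis by (intro AE_weights) simp
qed

lemma directed_time_tendsto:
  assumes v: "0 \<le> v"
  shows "AE \<omega> in env G. (\<lambda>n. directed_time \<omega> n 0 \<lceil>v * real n\<rceil> / real n) \<longlonglongrightarrow> speed v"
proof -
  define t where "t \<omega> n = directed_time \<omega> n 0 \<lceil>v * real n\<rceil>" for \<omega> n
  define a where "a n = mean_time n \<lceil>v * real n\<rceil>" for n
  obtain C where C: "0 \<le> C" "\<And>n b \<delta>. 0 < n \<Longrightarrow> 0 < \<delta> \<Longrightarrow>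
    prob {\<omega>. \<bar>directed_time \<omega> n 0 b - mean_time n b\<bar> \<ge> \<delta> * real n} \<le> C / (\<delta>\<^sup>2 * real n)"
    using deviation_bound by blast
  have tm[measurable]: "(\<lambda>\<omega>. t \<omega> n) \<in> borel_measurable (env G)" for n
    unfolding t_def by simp
  have bc: "AE \<omega> in env G. \<forall>\<^sub>F k in sequentially. \<bar>t \<omega> ((Suc k)\<^sup>2) - a ((Suc k)\<^sup>2)\<bar> < \<delta> * real ((Suc k)\<^sup>2)"
    if \<delta>: "0 < \<delta>" for \<delta>
  proof -
    let ?A = "\<lambda>k. {\<omega>. \<bar>t \<omega> ((Suc k)\<^sup>2) - a ((Suc k)\<^sup>2)\<bar> \<ge> \<delta> * real ((Suc k)\<^sup>2)}"
    have A: "?A k \<in> sets (env G)" for k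
    proof -
      have "{\<omega> \<in> space (env G). \<bar>t \<omega> ((Suc k)\<^sup>2) - a ((Suc k)\<^sup>2)\<bar> \<ge> \<delta> * real ((Suc k)\<^sup>2)} \<in> sets (env G)"
        by measurable
      then show ?thesis by (simp add: space_env)
    qed
    have "summable (\<lambda>k. C / \<delta>\<^sup>2 * (1 / real ((Suc k)\<^sup>2)))"
    proof (rule summable_mult)
      have "summable (\<lambda>k. 1 / (real k)\<^sup>2)"
        using inverse_power_summable[of 2, where 'a = real] by (simp add: inverse_eq_divide)
      then have "summable (\<lambda>k. 1 / (real (Suc k))\<^sup>2)"
        by (simp only: summable_Suc_iff[of "\<lambda>k. 1 / (real k)\<^sup>2"])
      then show "summable (\<lambda>k. 1 / real ((Suc k)\<^sup>2))" by (simp only: of_nat_power)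
    qed
    then have "summable (\<lambda>k. prob (?A k))"
    proof (rule summable_comparison_test')
      fix k
      have "prob (?A k) \<le> C / (\<delta>\<^sup>2 * real ((Suc k)\<^sup>2))"
        unfolding t_def a_def by (rule C(2)[OF _ \<delta>]) simp
      then show "norm (prob (?A k)) \<le> C / \<delta>\<^sup>2 * (1 / real ((Suc k)\<^sup>2))" by simp
    qed
    from borel_cantelli_AE1[OF A _ this] have "AE \<omega> in env G. \<forall>\<^sub>F k in sequentially. \<omega> \<in> space (env G) - ?A k"
      by (simp add: emeasure_eq_measure)
    then show ?thesis
      by eventually_elim (simp add: not_le space_env)
  qed
  \<comment> \<open>A single null set must serve all tolerances, so only the countably many values
    \<open>1 / (j + 1)\<close> are used.\<close>
  have "AE \<omega> in env G. \<forall>j. \<forall>\<^sub>F k in sequentially.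
      \<bar>t \<omega> ((Suc k)\<^sup>2) - a ((Suc k)\<^sup>2)\<bar> < (1 / real (Suc j)) * real ((Suc k)\<^sup>2)"
    unfolding AE_all_countable by (intro allI bc) simp
  then show ?thesis
  proof eventually_elim
    case (elim \<omega>)
    define q where "q k = (Suc k)\<^sup>2" for k :: nat
    have q: "0 < real (q k)" for k by (simp add: q_def)
    have "(\<lambda>k. (t \<omega> (q k) - a (q k)) / real (q k)) \<longlonglongrightarrow> 0"
    proof (rule LIMSEQ_I)
      fix r :: real assume "0 < r"
      then obtain j where j: "1 / real (Suc j) < r"
        using nat_approx_posE by blast
      obtain K where K: "\<And>k. k \<ge> K \<Longrightarrow> \<bar>t \<omega> (q k) - a (q k)\<bar> < (1 / real (Suc j)) * real (q k)"
        using elim unfolding eventually_sequentially q_def by blast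
      have "norm ((t \<omega> (q k) - a (q k)) / real (q k) - 0) < r" if "k \<ge> K" for k
      proof -
        have "\<bar>t \<omega> (q k) - a (q k)\<bar> / real (q k) < 1 / real (Suc j)"
          using K[OF that] q[of k] by (simp only: divide_less_eq if_True)
        then show ?thesis using j q[of k] by (simp add: abs_divide)
      qed
      then show "\<exists>K. \<forall>k\<ge>K. norm ((t \<omega> (q k) - a (q k)) / real (q k) - 0) < r" by blast
    qed
    moreover have "(\<lambda>k. a (q k) / real (q k)) \<longlonglongrightarrow> speed v"
    proof -
      have "filterlim q at_top sequentially"
        unfolding q_def by (rule filterlim_subseq) (auto simp: strict_mono_Suc_iff power2_eq_square)
      from filterlim_compose[OF mean_time_tendsto[of v] this] show ?thesis by (simp add: a_def)
    qed
    ultimately have "(\<lambda>k. (t \<omega> (q k) - a (q k)) / real (q k) + a (q k) / real (q k)) \<longlonglongrightarrow> 0 + speed v"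
      by (rule tendsto_add)
    then have "(\<lambda>k. t \<omega> (q k) / real (q k)) \<longlonglongrightarrow> speed v"
      by (simp add: add_divide_distrib[symmetric])
    then have "(\<lambda>k. t \<omega> (k\<^sup>2) / real (k\<^sup>2)) \<longlonglongrightarrow> speed v"
      unfolding q_def by (rule LIMSEQ_imp_Suc[of "\<lambda>k. t \<omega> (k\<^sup>2) / real (k\<^sup>2)"])
    \<comment> \<open>Dropping the columns beyond \<open>n\<close> is free. Moving the endpoint
      costs the difference of the ceilings, whose rounding gives the 1.\<close>
    moreover have "t \<omega> n \<le> t \<omega> m + v * (real m - real n) + 1" if "n \<le> m" for n m
    proof -
      have "v * real n \<le> v * real m" using that v by (intro mult_left_mono) auto
      then have "real_of_int \<bar>\<lceil>v * real n\<rceil> - \<lceil>v * real m\<rceil>\<bar> \<le> v * real m - v * real n + 1"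
        by linarith
      then show ?thesis
        using directed_time_mono[OF that, of \<omega> 0 "\<lceil>v * real n\<rceil>"]
          directed_time_Lipschitz[of \<omega> m 0 "\<lceil>v * real n\<rceil>" "\<lceil>v * real m\<rceil>"]
        by (simp add: t_def right_diff_distrib)
    qed
    ultimately show ?case
      using tendsto_from_squares[of "t \<omega>" v, OF _ v] by (simp add: t_def)
  qed
qed

text \<open>The definite description needs uniqueness too: two almost sure limits agree on an event
  of probability 1, which is nonempty.\<close>

lemma time_const_eq_speed:
  assumes v: "0 \<le> v"
  shows "time_const G v = speed v"
  unfolding time_const_def
proof (rule the_equality)
  show lim: "AE \<omega> in env G. (\<lambda>n. passage_time \<omega> (0, 0) (int n, \<lceil>v * real n\<rceil>) / real n) \<longlonglongrightarrow> speed v"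
    using directed_time_tendsto[OF v] AE_nonneg
  proof eventually_elim
    case (elim \<omega>)
    then have "passage_time \<omega> (0, 0) (int n, b) = directed_time \<omega> n 0 b" for n b
      by (intro passage_time_eq_directed_time) auto
    with elim(1) show ?case by simp
  qed
  fix c
  assume "AE \<omega> in env G. (\<lambda>n. passage_time \<omega> (0, 0) (int n, \<lceil>v * real n\<rceil>) / real n) \<longlonglongrightarrow> c"
  with lim have "AE \<omega> in env G. c = speed v"
    by eventually_elim (rule LIMSEQ_unique)
  then show "c = speed v" by simp
qed

end

section \<open>Bounds by greedy paths\<close>

primrec greedy :: "real set \<Rightarrow> (int \<times> int \<Rightarrow> real) \<Rightarrow> nat \<Rightarrow> nat" where
  "greedy B \<omega> 0 = 0"
| "greedy B \<omega> (Suc n) = greedy B \<omega> n + first_hit B \<omega> (int n, int (greedy B \<omega> n))"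

lemma greedy_cong:
  assumes "\<And>x y. 0 \<le> x \<Longrightarrow> x < int n \<Longrightarrow> \<omega> (x, y) = \<omega>' (x, y)"
  shows "greedy B \<omega> n = greedy B \<omega>' n"
  using assms by (induction n) (simp_all add: first_hit_def)

text \<open>A path that only climbs pays its height exactly once, so the excess over the height
  comes from the horizontal edges alone, at most \<open>b\<close> for each.\<close>

lemma directed_time_greedy:
  assumes "\<And>z. \<exists>k. \<omega> (fst z, snd z + int k) \<in> B" "B \<subseteq> {..b}" "\<And>z. 0 \<le> \<omega> z"
  shows "directed_time \<omega> n 0 (int (greedy B \<omega> n)) \<le> b * real n + real (greedy B \<omega> n)"
proof (induction n)
  case (Suc n)
  let ?g = "greedy B \<omega> n" and ?g' = "greedy B \<omega> (Suc n)"
  have "\<omega> (int n, int ?g') \<in> B"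
    using first_hit_in[of \<omega> "(int n, int ?g)" B] assms(1)[of "(int n, int ?g)"] by simp
  then have "\<bar>\<omega> (int n, int ?g')\<bar> \<le> b"
    using assms(2) assms(3)[of "(int n, int ?g')"] by (auto simp del: greedy.simps)
  moreover have "directed_time \<omega> n 0 (int ?g') \<le> directed_time \<omega> n 0 (int ?g) + (real ?g' - real ?g)"
    using directed_time_Lipschitz[of \<omega> n 0 "int ?g'" "int ?g"] by simp
  ultimately show ?case
    using Suc directed_time_Suc_le[of \<omega> n 0 "int ?g'" "int ?g'"]
    by (simp add: algebra_simps del: greedy.simps)
qed simp

context fpp
begin

lemma mean_time_lower:
  assumes t: "AE x in G. t \<le> x"
  shows "t * real n + real_of_int b \<le> mean_time n b"
proof -
  have "expectation (\<lambda>\<omega>. t * real n + real_of_int b) \<le> mean_time n b"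
    unfolding mean_time_def
  proof (rule integral_mono_AE)
    show "AE \<omega> in env G. t * real n + real_of_int b \<le> directed_time \<omega> n 0 b"
      using AE_weights[OF t]
    proof eventually_elim
      case (elim \<omega>)
      then have "t * real n + real_of_int (b - 0) \<le> directed_time \<omega> n 0 b"
        by (intro directed_time_lower) auto
      then show ?case by simp
    qed
  qed (simp_all add: directed_time_integrable)
  then show ?thesis by (simp add: prob_space)
qed

lemma speed_lower:
  assumes t: "AE x in G. t \<le> x"
  shows "v + t \<le> speed v"
proof (rule LIMSEQ_le_const[OF mean_time_tendsto], intro exI allI impI)
  fix n :: nat assume n: "1 \<le> n"
  have "v * real n \<le> real_of_int \<lceil>v * real n\<rceil>" by linarith
  then have "(v + t) * real n \<le> mean_time n \<lceil>v * real n\<rceil>"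
    using mean_time_lower[OF t, of n "\<lceil>v * real n\<rceil>"] unfolding distrib_right by linarith
  then show "v + t \<le> mean_time n \<lceil>v * real n\<rceil> / real n"
    using n by (simp add: le_divide_eq)
qed

lemma speed_nonneg: "0 \<le> v \<Longrightarrow> v \<le> speed v"
proof -
  have "AE x in G. x \<in> {0..}"
    using nonneg_G by (intro G.AE_prob_1)
  then have "AE x in G. 0 \<le> x" by simp
  from speed_lower[OF this, of v] show ?thesis by simp
qed

text \<open>In other words, \<open>speed v - v\<close> is nonincreasing, which is how it is
  used.\<close>

lemma speed_Lipschitz:
  assumes "v \<le> w"
  shows "speed w \<le> speed v + (w - v)"
proof (rule LIMSEQ_le)
  show "(\<lambda>n. mean_time n \<lceil>w * real n\<rceil> / real n) \<longlonglongrightarrow> speed w"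
    by (rule mean_time_tendsto)
  show "(\<lambda>n. mean_time n \<lceil>v * real n\<rceil> / real n + (w - v) + 1 / real n) \<longlonglongrightarrow> speed v + (w - v)"
    using tendsto_add[OF tendsto_add[OF mean_time_tendsto[of v] tendsto_const[of "w - v"]] lim_1_over_n] by simp
  show "\<exists>N. \<forall>n\<ge>N. mean_time n \<lceil>w * real n\<rceil> / real n
      \<le> mean_time n \<lceil>v * real n\<rceil> / real n + (w - v) + 1 / real n"
  proof (intro exI allI impI)
    fix n :: nat assume n: "1 \<le> n"
    have "v * real n \<le> w * real n" using assms by (intro mult_right_mono) auto
    then have "real_of_int \<bar>\<lceil>w * real n\<rceil> - \<lceil>v * real n\<rceil>\<bar> \<le> w * real n - v * real n + 1"
      by linarith
    then have "mean_time n \<lceil>w * real n\<rceil> \<le> mean_time n \<lceil>v * real n\<rceil> + (w - v) * real n + 1"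
      using mean_time_Lipschitz[of n "\<lceil>w * real n\<rceil>" "\<lceil>v * real n\<rceil>"] by (simp add: left_diff_distrib)
    then have "mean_time n \<lceil>w * real n\<rceil> / real n
        \<le> (mean_time n \<lceil>v * real n\<rceil> + (w - v) * real n + 1) / real n"
      by (rule divide_right_mono) simp
    then show "mean_time n \<lceil>w * real n\<rceil> / real n
        \<le> mean_time n \<lceil>v * real n\<rceil> / real n + (w - v) + 1 / real n"
      using n by (simp add: add_divide_distrib)
  qed
qed

lemma greedy_measurable [measurable]:
  assumes [measurable]: "B \<in> sets borel"
  shows "(\<lambda>\<omega>. greedy B \<omega> n) \<in> env G \<rightarrow>\<^sub>M count_space UNIV"
proof (induction n)
  case (Suc n)
  note [measurable] = Suc
  have "(\<lambda>\<omega>. (\<lambda>m \<omega>. m + first_hit B \<omega> (int n, int m)) (greedy B \<omega> n) \<omega>) \<in> env G \<rightarrow>\<^sub>M count_space UNIV"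
    by (rule measurable_compose_countable) measurable
  then show ?case by simp
qed simp

lemma real_greedy_measurable [measurable]:
  assumes "B \<in> sets borel"
  shows "(\<lambda>\<omega>. real (greedy B \<omega> n)) \<in> borel_measurable (env G)"
  by (rule measurable_compose[OF greedy_measurable[OF assms]]) simp

text \<open>The height before column \<open>n\<close> is read off the earlier columns. With column
  \<open>n\<close> fresh, the next climb is \<open>first_hit\<close> at a fixed point, whose mean is
  bounded uniformly in that point.\<close>

lemma greedy_mean:
  assumes B[measurable]: "B \<in> sets borel" and p: "measure G B > 0"
  obtains C where "0 \<le> C" "\<And>n. (\<integral>\<^sup>+\<omega>. ennreal (real (greedy B \<omega> n)) \<partial>env G) \<le> ennreal (C * real n)"
proof -
  obtain C where C: "0 \<le> C" "\<And>z. (\<integral>\<^sup>+\<omega>. ennreal ((0 + 1 * real (first_hit B \<omega> z))\<^sup>2) \<partial>env G) \<le> ennreal C"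
    using first_hit_affine_moment[OF B p, of 0 1] by blast
  have first: "(\<integral>\<^sup>+\<omega>. ennreal (real (first_hit B \<omega> z)) \<partial>env G) \<le> ennreal C" for z
  proof -
    \<comment> \<open>For natural numbers the second moment bounds the first.\<close>
    have "real m \<le> (real m)\<^sup>2" for m
      by (cases m) (simp_all add: power2_eq_square)
    then have "(\<integral>\<^sup>+\<omega>. ennreal (real (first_hit B \<omega> z)) \<partial>env G)
        \<le> (\<integral>\<^sup>+\<omega>. ennreal ((0 + 1 * real (first_hit B \<omega> z))\<^sup>2) \<partial>env G)"
      by (intro nn_integral_mono ennreal_leI) simp
    also have "\<dots> \<le> ennreal C" by (rule C)
    finally show ?thesis .
  qed
  have "(\<integral>\<^sup>+\<omega>. ennreal (real (greedy B \<omega> n)) \<partial>env G) \<le> ennreal (C * real n)" for n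
  proof (induction n)
    case (Suc n)
    let ?mix = "\<lambda>\<omega> \<omega>' z. if z \<in> column n then \<omega>' z else \<omega> z"
    have mix: "greedy B (?mix \<omega> \<omega>') (Suc n)
        = greedy B \<omega> n + first_hit B \<omega>' (int n, int (greedy B \<omega> n))" for \<omega> \<omega>' :: "int \<times> int \<Rightarrow> real"
    proof -
      have "greedy B (?mix \<omega> \<omega>') n = greedy B \<omega> n"
        by (rule greedy_cong) (simp add: column_def)
      then show ?thesis by (simp add: first_hit_def column_def)
    qed
    have "(\<integral>\<^sup>+\<omega>. ennreal (real (greedy B \<omega> (Suc n))) \<partial>env G)
        = (\<integral>\<^sup>+\<omega>. \<integral>\<^sup>+\<omega>'. ennreal (real (greedy B (?mix \<omega> \<omega>') (Suc n))) \<partial>env G \<partial>env G)"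
      by (rule nn_integral_mix) (intro measurable_compose[OF real_greedy_measurable[OF B]] measurable_ennreal)
    also have "\<dots> \<le> (\<integral>\<^sup>+\<omega>. ennreal (real (greedy B \<omega> n)) + ennreal C \<partial>env G)"
    proof (rule nn_integral_mono)
      fix \<omega>
      have "(\<integral>\<^sup>+\<omega>'. ennreal (real (greedy B (?mix \<omega> \<omega>') (Suc n))) \<partial>env G)
        = (\<integral>\<^sup>+\<omega>'. ennreal (real (greedy B \<omega> n))
            + ennreal (real (first_hit B \<omega>' (int n, int (greedy B \<omega> n)))) \<partial>env G)"
        by (simp only: mix of_nat_add ennreal_plus of_nat_0_le_iff)
      also have "\<dots> = ennreal (real (greedy B \<omega> n))
          + (\<integral>\<^sup>+\<omega>'. ennreal (real (first_hit B \<omega>' (int n, int (greedy B \<omega> n)))) \<partial>env G)"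
        by (subst nn_integral_add) (simp_all add: emeasure_space_1)
      also have "\<dots> \<le> ennreal (real (greedy B \<omega> n)) + ennreal C"
        by (intro add_left_mono first)
      finally show "(\<integral>\<^sup>+\<omega>'. ennreal (real (greedy B (?mix \<omega> \<omega>') (Suc n))) \<partial>env G)
          \<le> ennreal (real (greedy B \<omega> n)) + ennreal C" .
    qed
    also have "\<dots> = (\<integral>\<^sup>+\<omega>. ennreal (real (greedy B \<omega> n)) \<partial>env G) + ennreal C"
      by (subst nn_integral_add) (simp_all add: emeasure_space_1)
    also have "\<dots> \<le> ennreal (C * real n) + ennreal C"
      by (intro add_right_mono Suc)
    also have "\<dots> = ennreal (C * real (Suc n))"
      using C(1) by (simp add: ennreal_plus[symmetric] algebra_simps del: ennreal_plus)
    finally show ?case .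
  qed simp
  with C(1) show thesis by (rule that)
qed

text \<open>The greedy path is optimal up to \<open>b\<close> per column only where it stays below
  the target height. An event of probability at least 1/2 suffices, because concentration carries
  the bound from there to the mean. The lemma serves both the atom itself and intervals slightly
  above the smallest weight.\<close>

lemma speed_upper:
  assumes B[measurable]: "B \<in> sets borel" and p: "measure G B > 0" and Bb: "B \<subseteq> {..b}"
  obtains v where "0 < v" "speed v \<le> v + b"
proof -
  obtain M where M: "0 \<le> M" "\<And>n. (\<integral>\<^sup>+\<omega>. ennreal (real (greedy B \<omega> n)) \<partial>env G) \<le> ennreal (M * real n)"
    using greedy_mean[OF B p] by blast
  obtain C where C: "0 \<le> C" "\<And>n b \<delta>. 0 < n \<Longrightarrow> 0 < \<delta> \<Longrightarrow>
    prob {\<omega>. \<bar>directed_time \<omega> n 0 b - mean_time n b\<bar> \<ge> \<delta> * real n} \<le> C / (\<delta>\<^sup>2 * real n)"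
    using deviation_bound by blast
  \<comment> \<open>Makes \<open>M / v\<close> at most 1/2 in Markov's inequality, and
    \<open>v\<close> positive even if \<open>M\<close> is 0.\<close>
  define v where "v = 2 * M + 1"
  have v: "0 < v" using M(1) by (simp add: v_def)
  have half: "1 / 2 \<le> prob {\<omega>. real (greedy B \<omega> n) < v * real n}" if n: "0 < n" for n
  proof -
    have "emeasure (env G) {\<omega> \<in> space (env G). 1 \<le> ennreal (1 / (v * real n)) * ennreal (real (greedy B \<omega> n))}
        \<le> ennreal (1 / (v * real n)) * (\<integral>\<^sup>+\<omega>. ennreal (real (greedy B \<omega> n)) * indicator (space (env G)) \<omega> \<partial>env G)"
      by (rule nn_integral_Markov_inequality) simp_all
    also have "\<dots> \<le> ennreal (1 / (v * real n)) * ennreal (M * real n)"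
      using M(2)[of n] by (intro mult_left_mono) (simp_all add: space_env)
    also have "\<dots> = ennreal (M / v)"
      using n v M(1) by (simp add: ennreal_mult[symmetric])
    also have "\<dots> \<le> ennreal (1 / 2)"
      using M(1) by (intro ennreal_leI) (simp add: v_def field_simps)
    also have "{\<omega> \<in> space (env G). 1 \<le> ennreal (1 / (v * real n)) * ennreal (real (greedy B \<omega> n))}
        = {\<omega>. \<not> real (greedy B \<omega> n) < v * real n}"
      using n v by (auto simp: space_env ennreal_mult[symmetric] not_less field_simps)
    finally have "prob {\<omega>. \<not> real (greedy B \<omega> n) < v * real n} \<le> 1 / 2"
      by (subst (asm) emeasure_eq_measure, subst (asm) ennreal_le_iff) simp_all
    moreover have "prob {\<omega>. \<not> real (greedy B \<omega> n) < v * real n} = 1 - prob {\<omega>. real (greedy B \<omega> n) < v * real n}"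
    proof -
      have "{\<omega> \<in> space (env G). real (greedy B \<omega> n) < v * real n} \<in> sets (env G)"
        by measurable
      from prob_neg[OF this] show ?thesis by (simp add: space_env)
    qed
    ultimately show ?thesis by simp
  qed
  \<comment> \<open>From a greedy height below the target the rest is a pure climb, so the total
    vertical cost is the target height; the 1 pays for the ceiling.\<close>
  have ae: "AE \<omega> in env G. real (greedy B \<omega> n) < v * real n \<longrightarrow>
      directed_time \<omega> n 0 \<lceil>v * real n\<rceil> \<le> b * real n + v * real n + 1" for n
    using AE_hit[OF B p] AE_nonneg
  proof eventually_elim
    case (elim \<omega>)
    show ?case
    proof
      assume g: "real (greedy B \<omega> n) < v * real n"
      have "directed_time \<omega> n 0 (int (greedy B \<omega> n)) \<le> b * real n + real (greedy B \<omega> n)"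
        using elim Bb by (intro directed_time_greedy) auto
      then show "directed_time \<omega> n 0 \<lceil>v * real n\<rceil> \<le> b * real n + v * real n + 1"
        using directed_time_Lipschitz[of \<omega> n 0 "\<lceil>v * real n\<rceil>" "int (greedy B \<omega> n)"] g by linarith
    qed
  qed
  have "speed v \<le> (v + b) + \<delta>" if \<delta>: "0 < \<delta>" for \<delta>
  proof (rule LIMSEQ_le)
    show "(\<lambda>n. mean_time n \<lceil>v * real n\<rceil> / real n) \<longlonglongrightarrow> speed v"
      by (rule mean_time_tendsto)
    show "(\<lambda>n. (v + b) + \<delta> + 1 / real n) \<longlonglongrightarrow> (v + b) + \<delta>"
      using tendsto_add[OF tendsto_const lim_1_over_n, of "v + b + \<delta>"] by simp
    \<comment> \<open>Beyond \<open>N\<close> the deviation event has probability below 1/2, so it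
      cannot contain the event of \<open>half\<close>.\<close>
    obtain N where N: "2 * C / \<delta>\<^sup>2 < real N" using reals_Archimedean2 by blast
    have "mean_time n \<lceil>v * real n\<rceil> / real n \<le> (v + b) + \<delta> + 1 / real n" if n: "n \<ge> max N 1" for n
    proof (rule ccontr)
      assume "\<not> ?thesis"
      then have "mean_time n \<lceil>v * real n\<rceil> > b * real n + v * real n + 1 + \<delta> * real n"
        using n by (simp add: field_simps)
      with ae[of n] have "AE \<omega> in env G. \<omega> \<in> {\<omega>. real (greedy B \<omega> n) < v * real n} \<longrightarrow>
         \<omega> \<in> {\<omega>. \<bar>directed_time \<omega> n 0 \<lceil>v * real n\<rceil> - mean_time n \<lceil>v * real n\<rceil>\<bar> \<ge> \<delta> * real n}"
        by (auto elim!: eventually_mono)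
      then have "prob {\<omega>. real (greedy B \<omega> n) < v * real n}
          \<le> prob {\<omega>. \<bar>directed_time \<omega> n 0 \<lceil>v * real n\<rceil> - mean_time n \<lceil>v * real n\<rceil>\<bar> \<ge> \<delta> * real n}"
      proof (rule finite_measure_mono_AE)
        have "{\<omega> \<in> space (env G). \<bar>directed_time \<omega> n 0 \<lceil>v * real n\<rceil> - mean_time n \<lceil>v * real n\<rceil>\<bar> \<ge> \<delta> * real n}
            \<in> sets (env G)" by measurable
        then show "{\<omega>. \<bar>directed_time \<omega> n 0 \<lceil>v * real n\<rceil> - mean_time n \<lceil>v * real n\<rceil>\<bar> \<ge> \<delta> * real n} \<in> sets (env G)"
          by (simp add: space_env)
      qed
      also have "\<dots> \<le> C / (\<delta>\<^sup>2 * real n)"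
        using n \<delta> by (intro C) auto
      also have "\<dots> < 1 / 2"
      proof -
        have "2 * C / \<delta>\<^sup>2 < real n" using N n by linarith
        then show ?thesis using \<delta> n by (simp add: field_simps)
      qed
      finally show False using half[of n] n by simp
    qed
    then show "\<exists>N. \<forall>n\<ge>N. mean_time n \<lceil>v * real n\<rceil> / real n \<le> (v + b) + \<delta> + 1 / real n" by blast
  qed
  then have "speed v \<le> v + b" by (rule field_le_epsilon)
  with v show thesis by (rule that)
qed

end

section \<open>Strict lower bound\<close>

text \<open>The price of summing over all vertical moves within one column. Enumerating the integers
  makes \<open>nn_integral_suminf\<close> applicable.\<close>

definition row_weight :: ennreal where
  "row_weight = (\<Sum>k. ennreal (exp (- real_of_int \<bar>int_decode k\<bar>)))"

lemma suminf_int_decode: "(\<Sum>k. f (int_decode k)) = (\<integral>\<^sup>+y. f y \<partial>count_space UNIV)" for f :: "int \<Rightarrow> ennreal"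
proof -
  have "(\<Sum>k. f (int_decode k)) = (\<integral>\<^sup>+k. f (int_decode k) \<partial>count_space UNIV)"
    by (rule nn_integral_count_space_nat[symmetric])
  also have "\<dots> = (\<integral>\<^sup>+y. f y \<partial>count_space UNIV)"
    by (rule nn_integral_bij_count_space[OF bij_int_decode])
  finally show ?thesis .
qed

lemma row_weight_translate: "(\<Sum>k. ennreal (exp (- real_of_int \<bar>int_decode k - b\<bar>))) = row_weight"
proof -
  have "bij (\<lambda>y :: int. y - b)"
    by (rule bij_betw_byWitness[where f' = "\<lambda>y. y + b"]) auto
  from nn_integral_bij_count_space[OF this, of "\<lambda>y. ennreal (exp (- real_of_int \<bar>y\<bar>))"]
  show ?thesis
    unfolding row_weight_def suminf_int_decode[of "\<lambda>y. ennreal (exp (- real_of_int \<bar>y\<bar>))"]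
      suminf_int_decode[of "\<lambda>y. ennreal (exp (- real_of_int \<bar>y - b\<bar>))"] .
qed

text \<open>The decoding alternates between the two signs, so
  \<open>\<bar>int_decode k\<bar>\<close> is at least \<open>k div 2\<close> and a geometric series
  of ratio \<open>exp (- 1 / 2)\<close> dominates.\<close>

lemma row_weight_finite: "row_weight < \<infinity>"
proof -
  have "real k / 2 - 1 / 2 \<le> real_of_int \<bar>int_decode k\<bar>" for k
  proof -
    have "int (k div 2) \<le> \<bar>int_decode k\<bar>"
      by (simp add: int_decode_def sum_decode_def)
    moreover have "real k \<le> 2 * real (k div 2) + 1"
      by (cases "even k") (auto elim!: evenE oddE)
    ultimately show ?thesis by linarith
  qed
  then have "exp (- real_of_int \<bar>int_decode k\<bar>) \<le> exp (1 / 2) * exp (- (1 / 2)) ^ k" for k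
    by (simp add: exp_of_nat_mult[symmetric] exp_add[symmetric] algebra_simps)
  then have "row_weight \<le> (\<Sum>k. ennreal (exp (1 / 2) * exp (- (1 / 2)) ^ k))"
    unfolding row_weight_def by (intro suminf_le ennreal_leI summableI)
  also have "\<dots> = ennreal (\<Sum>k. exp (1 / 2) * exp (- (1 / 2)) ^ k)"
    by (rule suminf_ennreal2) (auto intro!: summable_mult summable_geometric)
  also have "\<dots> < \<infinity>" by simp
  finally show ?thesis .
qed

text \<open>The exponential turns the infimum over crossing heights into a supremum, bounded by the
  sum. Here the number of directed paths enters.\<close>

lemma exp_directed_time_Suc_le:
  "ennreal (exp (- directed_time \<omega> (Suc n) a b)) \<le>
     (\<Sum>k. ennreal (exp (- directed_time \<omega> n a (int_decode k))) * ennreal (exp (- \<bar>\<omega> (int n, int_decode k)\<bar>))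
       * ennreal (exp (- real_of_int \<bar>int_decode k - b\<bar>)))" (is "_ \<le> ?S")
proof (cases "?S = \<infinity>")
  case False
  then obtain r where r: "?S = ennreal r" "0 \<le> r" by (cases ?S) auto
  have term_le: "exp (- (directed_time \<omega> n a y + \<bar>\<omega> (int n, y)\<bar> + real_of_int \<bar>y - b\<bar>)) \<le> r" for y
  proof -
    let ?f = "\<lambda>k. ennreal (exp (- directed_time \<omega> n a (int_decode k))) * ennreal (exp (- \<bar>\<omega> (int n, int_decode k)\<bar>))
       * ennreal (exp (- real_of_int \<bar>int_decode k - b\<bar>))"
    have "?f (int_encode y) \<le> ?S"
      using sum_le_suminf[of ?f "{int_encode y}"] by simp
    then have "ennreal (exp (- (directed_time \<omega> n a y + \<bar>\<omega> (int n, y)\<bar> + real_of_int \<bar>y - b\<bar>))) \<le> ennreal r"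
      unfolding r by (simp add: ennreal_mult[symmetric] exp_add[symmetric] algebra_simps)
    then show ?thesis using r(2) by (simp only: ennreal_le_iff)
  qed
  have r0: "0 < r"
    by (rule less_le_trans[OF exp_gt_zero term_le])
  \<comment> \<open>Every term is at most \<open>r\<close>; taking logarithms turns this into a
    lower bound for each candidate of the infimum.\<close>
  have "- ln r \<le> directed_time \<omega> (Suc n) a b"
  proof (rule directed_time_Suc_greatest)
    fix y
    have "ln (exp (- (directed_time \<omega> n a y + \<bar>\<omega> (int n, y)\<bar> + real_of_int \<bar>y - b\<bar>))) \<le> ln r"
      using term_le[of y] r0 by (intro ln_mono) auto
    then show "- ln r \<le> directed_time \<omega> n a y + \<bar>\<omega> (int n, y)\<bar> + real_of_int \<bar>y - b\<bar>" by simp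
  qed
  then have "exp (- directed_time \<omega> (Suc n) a b) \<le> exp (ln r)" by simp
  then show ?thesis unfolding r using r0 by (intro ennreal_leI) simp
qed simp

text \<open>Jensen's inequality for \<open>exp (- x)\<close>, obtained from the tangent at the
  expectation.\<close>

lemma (in prob_space) le_expectation_if_exp_bound:
  assumes X: "integrable (M) X" and nonneg: "\<And>\<omega>. 0 \<le> X \<omega>"
    and le: "(\<integral>\<^sup>+\<omega>. ennreal (exp (- X \<omega>)) \<partial>M) \<le> ennreal (exp (- c))"
  shows "c \<le> expectation X"
proof -
  have [measurable]: "X \<in> borel_measurable (M)" using X by auto
  have e: "integrable (M) (\<lambda>\<omega>. exp (- X \<omega>))"
    by (rule integrable_const_bound[where B = 1]) (auto simp: nonneg)
  have "exp (- expectation X) = expectation (\<lambda>\<omega>. exp (- expectation X) * (1 + (expectation X - X \<omega>)))"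
    using X by (simp add: prob_space)
  also have "\<dots> \<le> expectation (\<lambda>\<omega>. exp (- X \<omega>))"
  proof (intro integral_mono e)
    fix \<omega>
    have "exp (- expectation X) * (1 + (expectation X - X \<omega>)) \<le> exp (- expectation X) * exp (expectation X - X \<omega>)"
      by (intro mult_left_mono exp_ge_add_one_self) simp
    then show "exp (- expectation X) * (1 + (expectation X - X \<omega>)) \<le> exp (- X \<omega>)"
      by (simp add: exp_add[symmetric])
  qed (use X in simp)
  also have "\<dots> \<le> exp (- c)"
    using le nn_integral_eq_integral[OF e] by simp
  finally show ?thesis by simp
qed

context fpp
begin

lemma tilted_measurable [measurable]:
  "(\<lambda>\<omega>. directed_time (\<lambda>z. \<kappa> * (\<omega> z - t)) n a b) \<in> borel_measurable (env G)"
proof (rule measurable_compose[OF _ directed_time_measurable])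
  have "(\<lambda>\<omega>. \<kappa> * (\<omega> z - t)) \<in> env G \<rightarrow>\<^sub>M G" for z
    unfolding measurable_cong_sets[OF refl sets_G] by measurable
  then show "(\<lambda>\<omega> z. \<kappa> * (\<omega> z - t)) \<in> env G \<rightarrow>\<^sub>M env G"
    unfolding env_def by (intro measurable_abs_UNIV)
qed

text \<open>The Laplace transform of the surplus \<open>x - t\<close> at \<kappa> when
  \<open>t\<close> is almost surely a lower bound of the weights; the absolute value mirrors the
  recursion of \<open>directed_time\<close>.\<close>

definition tilted_weight :: "real \<Rightarrow> real \<Rightarrow> ennreal" where
  "tilted_weight \<kappa> t = (\<integral>\<^sup>+x. ennreal (exp (- \<bar>\<kappa> * (x - t)\<bar>)) \<partial>G)"

text \<open>Each column contributes one factor: \<open>tilted_weight\<close> for the horizontal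
  edge, split off by resampling column \<open>n\<close>, and \<open>row_weight\<close> for the
  vertical moves.\<close>

lemma exp_tilted_time_le:
  "(\<integral>\<^sup>+\<omega>. ennreal (exp (- directed_time (\<lambda>z. \<kappa> * (\<omega> z - t)) n 0 b)) \<partial>env G)
     \<le> (tilted_weight \<kappa> t * row_weight) ^ n"
proof (induction n arbitrary: b)
  case 0
  have "(\<integral>\<^sup>+\<omega>. ennreal (exp (- directed_time (\<lambda>z. \<kappa> * (\<omega> z - t)) 0 0 b)) \<partial>env G) \<le> (\<integral>\<^sup>+\<omega>. 1 \<partial>env G)"
    by (intro nn_integral_mono) simp
  then show ?case by (simp add: emeasure_space_1)
next
  case (Suc n)
  let ?D = "\<lambda>\<omega>. directed_time (\<lambda>z. \<kappa> * (\<omega> z - t))"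
  let ?q = "tilted_weight \<kappa> t * row_weight"
  have indep: "(\<integral>\<^sup>+\<omega>. ennreal (exp (- ?D \<omega> n 0 y)) * ennreal (exp (- \<bar>\<kappa> * (\<omega> (int n, y) - t)\<bar>)) \<partial>env G)
      \<le> ?q ^ n * tilted_weight \<kappa> t" for y
  proof -
    have "(\<integral>\<^sup>+\<omega>. ennreal (exp (- ?D \<omega> n 0 y)) * ennreal (exp (- \<bar>\<kappa> * (\<omega> (int n, y) - t)\<bar>)) \<partial>env G)
      = (\<integral>\<^sup>+\<omega>. \<integral>\<^sup>+\<omega>'. ennreal (exp (- ?D (\<lambda>z. if z \<in> column n then \<omega>' z else \<omega> z) n 0 y))
          * ennreal (exp (- \<bar>\<kappa> * ((if (int n, y) \<in> column n then \<omega>' (int n, y) else \<omega> (int n, y)) - t)\<bar>))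
          \<partial>env G \<partial>env G)"
      by (rule nn_integral_mix) measurable
    also have "\<dots> = (\<integral>\<^sup>+\<omega>. \<integral>\<^sup>+\<omega>'. ennreal (exp (- ?D \<omega> n 0 y))
          * ennreal (exp (- \<bar>\<kappa> * (\<omega>' (int n, y) - t)\<bar>)) \<partial>env G \<partial>env G)"
    proof -
      have "?D (\<lambda>z. if z \<in> column n then \<omega>' z else \<omega> z) n 0 y = ?D \<omega> n 0 y" for \<omega> \<omega>'
        by (rule directed_time_cong) (simp add: column_def)
      then show ?thesis by (simp add: column_def)
    qed
    also have "\<dots> = (\<integral>\<^sup>+\<omega>. ennreal (exp (- ?D \<omega> n 0 y)) * tilted_weight \<kappa> t \<partial>env G)"
    proof -
      have "(\<integral>\<^sup>+\<omega>'. ennreal (exp (- \<bar>\<kappa> * (\<omega>' (int n, y) - t)\<bar>)) \<partial>env G) = tilted_weight \<kappa> t"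
        unfolding tilted_weight_def
        by (subst (2) distr_component[of "(int n, y)", symmetric], subst nn_integral_distr)
          (simp_all add: measurable_cong_sets[OF sets_G refl])
      then show ?thesis by (subst nn_integral_cmult) simp_all
    qed
    also have "\<dots> = (\<integral>\<^sup>+\<omega>. ennreal (exp (- ?D \<omega> n 0 y)) \<partial>env G) * tilted_weight \<kappa> t"
      by (rule nn_integral_multc) measurable
    also have "\<dots> \<le> ?q ^ n * tilted_weight \<kappa> t"
      by (intro mult_right_mono Suc) simp
    finally show ?thesis .
  qed
  have "(\<integral>\<^sup>+\<omega>. ennreal (exp (- ?D \<omega> (Suc n) 0 b)) \<partial>env G)
    \<le> (\<integral>\<^sup>+\<omega>. (\<Sum>k. ennreal (exp (- ?D \<omega> n 0 (int_decode k)))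
        * ennreal (exp (- \<bar>\<kappa> * (\<omega> (int n, int_decode k) - t)\<bar>))
        * ennreal (exp (- real_of_int \<bar>int_decode k - b\<bar>))) \<partial>env G)"
    by (intro nn_integral_mono exp_directed_time_Suc_le)
  also have "\<dots> = (\<Sum>k. \<integral>\<^sup>+\<omega>. ennreal (exp (- ?D \<omega> n 0 (int_decode k)))
        * ennreal (exp (- \<bar>\<kappa> * (\<omega> (int n, int_decode k) - t)\<bar>))
        * ennreal (exp (- real_of_int \<bar>int_decode k - b\<bar>)) \<partial>env G)"
    by (rule nn_integral_suminf) measurable
  also have "\<dots> \<le> (\<Sum>k. ?q ^ n * tilted_weight \<kappa> t * ennreal (exp (- real_of_int \<bar>int_decode k - b\<bar>)))"
  proof (intro suminf_le summableI)
    fix k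
    show "(\<integral>\<^sup>+\<omega>. ennreal (exp (- ?D \<omega> n 0 (int_decode k)))
        * ennreal (exp (- \<bar>\<kappa> * (\<omega> (int n, int_decode k) - t)\<bar>))
        * ennreal (exp (- real_of_int \<bar>int_decode k - b\<bar>)) \<partial>env G)
      \<le> ?q ^ n * tilted_weight \<kappa> t * ennreal (exp (- real_of_int \<bar>int_decode k - b\<bar>))"
      by (subst nn_integral_multc) (auto intro!: mult_right_mono indep)
  qed
  also have "\<dots> = ?q ^ n * tilted_weight \<kappa> t * row_weight"
    by (simp only: ennreal_suminf_cmult row_weight_translate)
  finally show ?case by (simp only: power_Suc mult_ac)
qed

text \<open>Dominated convergence: almost surely the surplus is strictly positive, so the integrand
  tends to 0.\<close>

lemma tilted_weight_small:
  assumes t: "AE x in G. t < x" and "0 < \<epsilon>"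
  obtains \<kappa> where "1 \<le> \<kappa>" "tilted_weight \<kappa> t < ennreal \<epsilon>"
proof -
  have "(\<lambda>m. \<integral>x. exp (- \<bar>real (Suc m) * (x - t)\<bar>) \<partial>G) \<longlonglongrightarrow> (\<integral>x. 0 \<partial>G)"
  proof (rule integral_dominated_convergence[where w = "\<lambda>_. 1"])
    show "AE x in G. (\<lambda>m. exp (- \<bar>real (Suc m) * (x - t)\<bar>)) \<longlonglongrightarrow> 0"
      using t
    proof eventually_elim
      case (elim x)
      have "(\<lambda>m. exp (- (x - t)) ^ Suc m) \<longlonglongrightarrow> 0"
        using elim by (intro LIMSEQ_Suc LIMSEQ_power_zero) simp
      moreover have "exp (- (x - t)) ^ Suc m = exp (- \<bar>real (Suc m) * (x - t)\<bar>)" for m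
      proof -
        have "\<bar>real (Suc m) * (x - t)\<bar> = real (Suc m) * (x - t)"
          using elim by (intro abs_of_nonneg mult_nonneg_nonneg) auto
        then show ?thesis by (simp only: exp_of_nat_mult[symmetric] mult_minus_right)
      qed
      ultimately show ?case by (simp only:)
    qed
  qed (auto simp: measurable_cong_sets[OF sets_G refl])
  then have "\<forall>\<^sub>F m in sequentially. (\<integral>x. exp (- \<bar>real (Suc m) * (x - t)\<bar>) \<partial>G) < \<epsilon>"
    using assms(2) by (intro order_tendstoD(2)[of _ 0]) simp_all
  then obtain m where m: "(\<integral>x. exp (- \<bar>real (Suc m) * (x - t)\<bar>) \<partial>G) < \<epsilon>"
    by (auto simp: eventually_sequentially)
  have "integrable G (\<lambda>x. exp (- \<bar>real (Suc m) * (x - t)\<bar>))"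
    by (rule G.integrable_const_bound[where B = 1]) (auto simp: measurable_cong_sets[OF sets_G refl])
  then have "tilted_weight (real (Suc m)) t = ennreal (\<integral>x. exp (- \<bar>real (Suc m) * (x - t)\<bar>) \<partial>G)"
    unfolding tilted_weight_def by (rule nn_integral_eq_integral) simp
  with m have "tilted_weight (real (Suc m)) t < ennreal \<epsilon>"
    by (simp add: ennreal_less_iff)
  then show thesis by (intro that[of "real (Suc m)"]) auto
qed

lemma speed_strict_lower:
  assumes t: "AE x in G. t < x" and t0: "0 \<le> t"
  shows "v + t < speed v"
proof -
  \<comment> \<open>Makes the factor per column at most \<open>exp (- (v + 3))\<close>. Of the
    resulting growth \<open>(v + 3) * n\<close>, the endpoint height takes at most
    \<open>v * n + 1\<close>, leaving at least \<open>2 * n\<close>.\<close>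
  define \<epsilon> where "\<epsilon> = exp (- (v + 3)) / (enn2real row_weight + 1)"
  have row: "row_weight = ennreal (enn2real row_weight)"
    using row_weight_finite by simp
  have "0 < \<epsilon>"
    unfolding \<epsilon>_def by (intro divide_pos_pos add_nonneg_pos) auto
  then obtain \<kappa> where \<kappa>: "1 \<le> \<kappa>" "tilted_weight \<kappa> t < ennreal \<epsilon>"
    using tilted_weight_small[OF t] by blast
  have q: "tilted_weight \<kappa> t * row_weight \<le> ennreal (exp (- (v + 3)))"
  proof -
    have "tilted_weight \<kappa> t * row_weight \<le> ennreal \<epsilon> * ennreal (enn2real row_weight)"
      using \<kappa>(2) row by (intro mult_mono) auto
    also have "\<dots> = ennreal (\<epsilon> * enn2real row_weight)"
      using \<open>0 < \<epsilon>\<close> by (simp add: ennreal_mult)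
    also have "\<epsilon> * enn2real row_weight \<le> exp (- (v + 3))"
      unfolding \<epsilon>_def by (simp add: divide_le_eq add_nonneg_pos mult_left_mono)
    finally show ?thesis by (simp add: ennreal_leI)
  qed
  let ?D = "\<lambda>\<omega>. directed_time (\<lambda>z. \<kappa> * (\<omega> z - t))"
  have tilt: "AE \<omega> in env G. ?D \<omega> n 0 b
      \<le> \<kappa> * (directed_time \<omega> n 0 b - t * real n - real_of_int b) + real_of_int b" for n b
    using AE_weights[OF t]
  proof eventually_elim
    case (elim \<omega>)
    then have "?D \<omega> n 0 b \<le> \<kappa> * (directed_time \<omega> n 0 b - t * real n - real_of_int (b - 0)) + real_of_int (b - 0)"
      using \<kappa>(1) t0 by (intro directed_time_tilt) (auto intro: less_imp_le)
    then show ?case by simp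
  qed
  have int_rhs: "integrable (env G) (\<lambda>\<omega>. \<kappa> * (directed_time \<omega> n 0 b - t * real n - real_of_int b) + real_of_int b)" for n b
    by (simp add: directed_time_integrable)
  \<comment> \<open>\<open>directed_time_integrable\<close> concerns untilted environments; the
    tilted time inherits integrability from its upper bound.\<close>
  have int_D: "integrable (env G) (\<lambda>\<omega>. ?D \<omega> n 0 b)" for n b
  proof (rule Bochner_Integration.integrable_bound[OF int_rhs])
    show "AE \<omega> in env G. norm (?D \<omega> n 0 b)
        \<le> norm (\<kappa> * (directed_time \<omega> n 0 b - t * real n - real_of_int b) + real_of_int b)"
      using tilt[of n b]
    proof eventually_elim
      case (elim \<omega>)
      then show ?case using directed_time_nonneg[of "\<lambda>z. \<kappa> * (\<omega> z - t)" n 0 b] by simp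
    qed
  qed simp
  have mean: "t * real n + real_of_int b + ((v + 3) * real n - real_of_int b) / \<kappa> \<le> mean_time n b" for n b
  proof -
    have "(\<integral>\<^sup>+\<omega>. ennreal (exp (- ?D \<omega> n 0 b)) \<partial>env G) \<le> (tilted_weight \<kappa> t * row_weight) ^ n"
      by (rule exp_tilted_time_le)
    also have "\<dots> \<le> ennreal (exp (- (v + 3))) ^ n"
      by (intro power_mono q) simp
    also have "\<dots> = ennreal (exp (- ((v + 3) * real n)))"
      by (simp add: ennreal_power exp_of_nat_mult[symmetric] algebra_simps)
    finally have "(v + 3) * real n \<le> expectation (\<lambda>\<omega>. ?D \<omega> n 0 b)"
      by (intro le_expectation_if_exp_bound int_D directed_time_nonneg)
    also have "\<dots> \<le> expectation (\<lambda>\<omega>. \<kappa> * (directed_time \<omega> n 0 b - t * real n - real_of_int b) + real_of_int b)"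
      by (intro integral_mono_AE int_D int_rhs tilt)
    also have "\<dots> = \<kappa> * (mean_time n b - t * real n - real_of_int b) + real_of_int b"
      by (simp add: directed_time_integrable mean_time_def prob_space)
    finally have "((v + 3) * real n - real_of_int b) / \<kappa> \<le> mean_time n b - t * real n - real_of_int b"
      using \<kappa>(1) by (simp add: divide_le_eq mult.commute)
    then show ?thesis by simp
  qed
  have "v + t + 2 / \<kappa> \<le> speed v"
  proof (rule LIMSEQ_le_const[OF mean_time_tendsto], intro exI allI impI)
    fix n :: nat assume n: "1 \<le> n"
    let ?b = "\<lceil>v * real n\<rceil>"
    have "real_of_int ?b \<le> v * real n + 1" by linarith
    have "2 * real n \<le> (v + 3) * real n - real_of_int ?b"
    proof -
      have "1 \<le> real n" using n by simp
      with \<open>real_of_int ?b \<le> v * real n + 1\<close> show ?thesis unfolding distrib_right by linarith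
    qed
    then have "2 * real n / \<kappa> \<le> ((v + 3) * real n - real_of_int ?b) / \<kappa>"
      using \<kappa>(1) by (intro divide_right_mono) auto
    then have "t * real n + v * real n + 2 * real n / \<kappa> \<le> mean_time n ?b"
      using mean[of n ?b] le_of_int_ceiling[of "v * real n"] by linarith
    then have "(v + t + 2 / \<kappa>) * real n \<le> mean_time n ?b"
      by (simp add: algebra_simps)
    then show "v + t + 2 / \<kappa> \<le> mean_time n ?b / real n"
      using n by (simp add: le_divide_eq)
  qed
  moreover have "0 < 2 / \<kappa>" using \<kappa>(1) by simp
  ultimately show ?thesis by linarith
qed

end

section \<open>The limit shape\<close>

text \<open>Absolute values merge the four reflected arcs and also cover a negative
  \<open>shape_radius\<close>, which is not excluded for an arbitrary measure.\<close>

lemma shape_boundary_cases: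
  assumes "z \<in> shape_boundary G"
  obtains \<theta> where "0 \<le> \<theta>" "\<theta> \<le> pi / 2"
    "\<bar>Re z\<bar> = \<bar>shape_radius G \<theta>\<bar> * cos \<theta>" "\<bar>Im z\<bar> = \<bar>shape_radius G \<theta>\<bar> * sin \<theta>"
proof -
  obtain \<theta> where \<theta>: "0 \<le> \<theta>" "\<theta> \<le> pi / 2" and
    z: "z = shape_radius G \<theta> * cis \<theta> \<or> z = shape_radius G \<theta> * cis (-\<theta>) \<or>
       z = - (shape_radius G \<theta> * cis \<theta>) \<or> z = - (shape_radius G \<theta> * cis (-\<theta>))"
    using assms unfolding shape_boundary_def Let_def by auto
  have "0 \<le> cos \<theta>" "0 \<le> sin \<theta>"
    using \<theta> by (auto intro!: cos_ge_zero sin_ge_zero)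
  with z have "\<bar>Re z\<bar> = \<bar>shape_radius G \<theta>\<bar> * cos \<theta>" "\<bar>Im z\<bar> = \<bar>shape_radius G \<theta>\<bar> * sin \<theta>"
    by (auto simp: abs_mult)
  with \<theta> show thesis by (rule that)
qed

text \<open>The value 0 must be allowed because \<open>shape_radius\<close> is 0 by division by zero
  where \<open>time_const\<close> vanishes. Three isolated values still exclude a vertical
  segment.\<close>

lemma shape_boundary_Re_eq_0:
  assumes "z \<in> shape_boundary G" "Re z = 0"
  shows "Im z \<in> {-1, 0, 1}"
  using assms(1)
proof (cases rule: shape_boundary_cases)
  case (1 \<theta>)
  show ?thesis
  proof (cases "\<theta> = pi / 2")
    case True
    have "\<bar>Im z\<bar> = 1" using 1(4) unfolding True by (simp add: shape_radius_def)
    then show ?thesis by auto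
  next
    case False
    then have "cos \<theta> \<noteq> 0" using 1 by (intro less_imp_neq[THEN not_sym] cos_gt_zero_pi) auto
    then have "shape_radius G \<theta> = 0" using 1 assms(2) by auto
    then show ?thesis using 1 by auto
  qed
qed

lemma imaginary_unit_in_shape_boundary: "\<i> \<in> shape_boundary G"
  unfolding shape_boundary_def Let_def
  by (rule CollectI, rule bexI[of _ "pi / 2"]) (auto simp: shape_radius_def complex_eq_iff)

text \<open>Parametrises the boundary by the slope \<open>v\<close> instead of the angle
  \<open>arctan v\<close>.\<close>

lemma shape_boundary_memI:
  assumes "0 \<le> v" "time_const G v \<noteq> 0"
  shows "Complex (1 / time_const G v) (v / time_const G v) \<in> shape_boundary G"
proof -
  let ?\<theta> = "arctan v"
  have "0 \<le> ?\<theta>" "?\<theta> < pi / 2" using assms arctan_ubound by (auto simp: zero_le_arctan_iff)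
  moreover have "cos ?\<theta> > 0" by (rule cos_gt_zero_pi[OF arctan_lbound arctan_ubound])
  moreover have "sin ?\<theta> = v * cos ?\<theta>"
    using tan_arctan[of v] \<open>cos ?\<theta> > 0\<close> by (simp add: tan_def field_simps)
  ultimately have "Complex (1 / time_const G v) (v / time_const G v) = shape_radius G ?\<theta> * cis ?\<theta>"
    using assms by (simp add: complex_eq_iff shape_radius_def tan_arctan)
  then show ?thesis
    unfolding shape_boundary_def Let_def using \<open>0 \<le> ?\<theta>\<close> \<open>?\<theta> < pi / 2\<close>
    by (intro CollectI bexI[of _ ?\<theta>]) auto
qed

lemma shape_boundary_time_const:
  assumes "z \<in> shape_boundary G" "Re z \<noteq> 0"
  shows "\<bar>Re z\<bar> * \<bar>time_const G (\<bar>Im z\<bar> / \<bar>Re z\<bar>)\<bar> = 1"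
  using assms(1)
proof (cases rule: shape_boundary_cases)
  case (1 \<theta>)
  have "\<theta> \<noteq> pi / 2"
  proof
    assume "\<theta> = pi / 2"
    then have "cos \<theta> = 0" by (simp only: cos_pi_half)
    then show False using 1 assms(2) by simp
  qed
  then have c: "cos \<theta> > 0" using 1 by (intro cos_gt_zero_pi) auto
  have "shape_radius G \<theta> \<noteq> 0" using 1 assms(2) by auto
  then have "\<bar>Im z\<bar> / \<bar>Re z\<bar> = tan \<theta>" unfolding 1 using c by (simp add: tan_def)
  moreover have "\<bar>Re z\<bar> = 1 / \<bar>time_const G (tan \<theta>)\<bar>"
    unfolding 1 using c \<open>\<theta> \<noteq> pi / 2\<close> by (simp add: shape_radius_def abs_mult)
  ultimately show ?thesis using assms(2) by auto
qed

section \<open>The smallest weight and the two directions of the equivalence\<close>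

context fpp
begin

definition min_weight :: real where
  "min_weight = Inf {x. measure G {0..x} > 0}"

lemma positive_mass_set:
  "{x. measure G {0..x} > 0} \<noteq> {}" "bdd_below {x. measure G {0..x} > 0}"
  "x \<in> {x. measure G {0..x} > 0} \<Longrightarrow> 0 \<le> x"
proof -
  obtain K where K: "0 \<le> K" "measure G {-K..K} > 0" by (rule bounded_weight_set)
  have "AE x in G. x \<in> {0..}" using nonneg_G by (intro G.AE_prob_1)
  then have "measure G {-K..K} \<le> measure G {0..K}"
    by (intro G.finite_measure_mono_AE) (auto simp: sets_G elim!: eventually_mono)
  then have "0 < measure G {0..K}" using K by linarith
  then show "{x. measure G {0..x} > 0} \<noteq> {}" by blast
  show *: "0 \<le> x" if "x \<in> {x. measure G {0..x} > 0}" for x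
    using that by (cases "0 \<le> x") auto
  then show "bdd_below {x. measure G {0..x} > 0}" by (intro bdd_belowI[of _ 0])
qed

lemma min_weight_nonneg: "0 \<le> min_weight"
  unfolding min_weight_def using positive_mass_set by (intro cInf_greatest)

text \<open>The weights in \<open>{0..<min_weight}\<close> are covered by countably many null
  intervals that stop short of the infimum.\<close>

lemma AE_min_weight_le: "AE x in G. min_weight \<le> x"
proof -
  have "{0..min_weight - 1 / real (Suc n)} \<in> null_sets G" for n
  proof -
    have "min_weight - 1 / real (Suc n) \<notin> {x. measure G {0..x} > 0}"
    proof
      assume "min_weight - 1 / real (Suc n) \<in> {x. measure G {0..x} > 0}"
      then have "min_weight \<le> min_weight - 1 / real (Suc n)"
        by (subst (1) min_weight_def) (intro cInf_lower positive_mass_set)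
      then show False by simp
    qed
    then show ?thesis
      by (simp add: null_sets_def sets_G G.emeasure_eq_measure measure_le_0_iff not_less)
  qed
  then have "AE x in G. \<forall>n. x \<notin> {0..min_weight - 1 / real (Suc n)}"
    by (simp add: AE_all_countable AE_not_in del: atLeastAtMost_iff)
  moreover have "AE x in G. x \<in> {0..}" using nonneg_G by (intro G.AE_prob_1)
  ultimately show ?thesis
  proof eventually_elim
    case (elim x)
    show ?case
    proof (rule ccontr)
      assume "\<not> min_weight \<le> x"
      then obtain n where "1 / real (Suc n) < min_weight - x"
        using nat_approx_posE[of "min_weight - x"] by auto
      then have "x \<in> {0..min_weight - 1 / real (Suc n)}" using elim(2) by simp
      then show False using elim(1) by blast
    qed
  qed
qed

lemma mass_above_min_weight:
  assumes "0 < \<epsilon>"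
  shows "measure G {0..min_weight + \<epsilon>} > 0"
proof -
  obtain x where x: "measure G {0..x} > 0" "x < min_weight + \<epsilon>"
    using cInf_lessD[OF positive_mass_set(1), of "min_weight + \<epsilon>"] assms
    by (auto simp: min_weight_def)
  then have "measure G {0..x} \<le> measure G {0..min_weight + \<epsilon>}"
    by (intro G.finite_measure_mono) (auto simp: sets_G)
  with x(1) show ?thesis by simp
qed

lemma flat_edge_if_atom:
  assumes "measure G {min_weight} > 0"
  shows "on_flat_edge G \<i>"
proof -
  obtain v0 where v0: "0 < v0" "speed v0 \<le> v0 + min_weight"
    using speed_upper[of "{min_weight}" min_weight] assms by auto
  define L where "L = v0 + min_weight"
  have L: "0 < L" using v0 min_weight_nonneg by (simp add: L_def)
  \<comment> \<open>The excess over \<open>v\<close> is nonincreasing, never below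
    \<open>min_weight\<close>, and already at most \<open>min_weight\<close> at
    \<open>v0\<close>.\<close>
  have tc: "time_const G v = v + min_weight" if "v0 \<le> v" for v
    using speed_Lipschitz[OF that] v0 speed_lower[OF AE_min_weight_le, of v] that
    by (simp add: time_const_eq_speed)
  define y where "y = Complex (1 / L) (v0 / L)"
  have seg: "(1 - s) *\<^sub>R \<i> + s *\<^sub>R y \<in> shape_boundary G" if s: "0 \<le> s" "s \<le> 1" for s
  proof (cases "s = 0")
    case True
    then show ?thesis by (simp add: imaginary_unit_in_shape_boundary)
  next
    case False
    then have s0: "0 < s" using s by simp
    \<comment> \<open>The slope of the ray through the point with parameter \<open>s\<close>; it is
      chosen so that \<open>time_const G v\<close> equals \<open>L / s\<close> and tends to infinity
      as \<open>s\<close> tends to 0.\<close>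
    define v where "v = v0 + (1 - s) * L / s"
    have v: "v0 \<le> v" unfolding v_def using s0 s L by simp
    have t: "time_const G v = L / s"
      using tc[OF v] s0 by (simp add: v_def L_def field_simps)
    have "Complex (1 / time_const G v) (v / time_const G v) \<in> shape_boundary G"
      using v v0 t L s0 by (intro shape_boundary_memI) auto
    moreover have "Complex (1 / time_const G v) (v / time_const G v) = (1 - s) *\<^sub>R \<i> + s *\<^sub>R y"
      unfolding t y_def using s0 L by (simp add: complex_eq_iff v_def field_simps)
    ultimately show ?thesis by simp
  qed
  have "y \<in> shape_boundary G" using seg[of 1] by simp
  moreover have "y \<noteq> \<i>" using L by (simp add: y_def complex_eq_iff)
  moreover have "closed_segment \<i> y \<subseteq> shape_boundary G"
    using seg by (auto simp: closed_segment_def)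
  ultimately show ?thesis
    unfolding on_flat_edge_def using imaginary_unit_in_shape_boundary by blast
qed

text \<open>A flat edge makes \<open>speed v - v\<close> equal to a constant \<open>c\<close> for
  large \<open>v\<close>. Without an atom \<open>c\<close> exceeds \<open>min_weight\<close>, but
  greedy paths through weights near \<open>min_weight\<close> push the nonincreasing excess below
  \<open>c\<close>.\<close>

lemma atom_if_flat_edge:
  assumes "on_flat_edge G \<i>"
  shows "measure G {min_weight} > 0"
proof (rule ccontr)
  assume "\<not> ?thesis"
  then have "measure G {min_weight} = 0" using measure_nonneg[of G "{min_weight}"] by linarith
  then have "{min_weight} \<in> null_sets G"
    by (simp add: null_sets_def sets_G G.emeasure_eq_measure)
  from AE_not_in[OF this] AE_min_weight_le have strict: "AE x in G. min_weight < x"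
    by eventually_elim simp
  obtain y where y: "y \<in> shape_boundary G" "y \<noteq> \<i>" and seg: "closed_segment \<i> y \<subseteq> shape_boundary G"
    using assms unfolding on_flat_edge_def by blast
  have point: "(1 - s) *\<^sub>R \<i> + s *\<^sub>R y \<in> shape_boundary G" if "0 \<le> s" "s \<le> 1" for s
    using seg that by (auto simp: closed_segment_def)
  have "Re y \<noteq> 0"
  proof
    assume re: "Re y = 0"
    with y have "Im y = 0 \<or> Im y = -1"
      using shape_boundary_Re_eq_0[OF y(1)] by (auto simp: complex_eq_iff)
    then show False
      \<comment> \<open>If \<open>Im y\<close> is -1, the midpoint is 0, an allowed value, so the
        quarter point is needed as well.\<close>
      using shape_boundary_Re_eq_0[OF point[of "1 / 2"]] shape_boundary_Re_eq_0[OF point[of "1 / 4"]] re by auto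
  qed
  define a where "a = \<bar>Re y\<bar>"
  \<comment> \<open>The line through \<open>\<i>\<close> and the reflected point
    \<open>(a, Im y)\<close> is \<open>Im = 1 - c * Re\<close>.\<close>
  define c where "c = (1 - Im y) / a"
  have a: "0 < a" using \<open>Re y \<noteq> 0\<close> by (simp add: a_def)
  have linear: "speed v = v + c" if v: "0 \<le> v" "1 / a \<le> v + c" for v
  proof -
    \<comment> \<open>The parameter at which the segment meets the ray of slope \<open>v\<close>;
      the condition \<open>1 / a \<le> v + c\<close> ensures \<open>s \<le> 1\<close>.\<close>
    define s where "s = 1 / ((v + c) * a)"
    have vc: "0 < v + c" using v a by (meson less_le_trans zero_less_divide_1_iff)
    have "1 \<le> (v + c) * a" using v(2) a by (simp add: divide_le_eq)
    then have s: "0 < s" "s \<le> 1" by (auto simp: s_def)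
    define z where "z = (1 - s) *\<^sub>R \<i> + s *\<^sub>R y"
    have z: "z \<in> shape_boundary G" unfolding z_def using s by (intro point) auto
    have re: "\<bar>Re z\<bar> = s * a" using s by (simp add: z_def a_def abs_mult)
    have "c * a = 1 - Im y" using a by (simp add: c_def)
    moreover have "Im z = 1 - s * (1 - Im y)" by (simp add: z_def algebra_simps)
    ultimately have "Im z = 1 - s * (c * a)" by (simp only:)
    also have "\<dots> = v * (s * a)"
    proof -
      have "s * ((v + c) * a) = 1" using vc a by (simp add: s_def)
      then show ?thesis by (simp add: algebra_simps)
    qed
    finally have im: "\<bar>Im z\<bar> = v * (s * a)" using s a v by simp
    have "\<bar>Im z\<bar> / \<bar>Re z\<bar> = v" unfolding re im using s a by simp
    moreover have "Re z \<noteq> 0" using re s a by auto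
    ultimately have "s * a * \<bar>time_const G v\<bar> = 1"
      using shape_boundary_time_const[OF z] re by simp
    moreover have "0 \<le> speed v" using speed_nonneg[OF v(1)] v(1) by linarith
    ultimately have "s * a * speed v = 1" using v by (simp add: time_const_eq_speed)
    moreover have "s * a = 1 / (v + c)" using a by (simp add: s_def)
    ultimately show ?thesis using vc by (simp add: divide_eq_eq)
  qed
  define w where "w = \<bar>1 / a - c\<bar>"
  have w: "speed v = v + c" if "w \<le> v" for v
    using that unfolding w_def by (intro linear) auto
  have "min_weight < c"
    using speed_strict_lower[OF strict min_weight_nonneg, of w] w[of w] by simp
  \<comment> \<open>Half of the gap between \<open>min_weight\<close> and \<open>c\<close> is enough
    room for \<open>speed_upper\<close> to beat \<open>c\<close> at some \<open>v\<close>.\<close>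
  then obtain v where v: "0 < v" "speed v \<le> v + (min_weight + (c - min_weight) / 2)"
    using speed_upper[of "{0..min_weight + (c - min_weight) / 2}" "min_weight + (c - min_weight) / 2"]
      mass_above_min_weight[of "(c - min_weight) / 2"] by auto
  have "speed (max v w) \<le> speed v + (max v w - v)" by (rule speed_Lipschitz) simp
  moreover have "speed (max v w) = max v w + c" by (rule w) simp
  ultimately show False using v(2) \<open>min_weight < c\<close> by (simp only:) argo
qed

end

theorem mainTheorem1:
  fixes G :: "real measure"
  assumes "prob_space G"
    and "sets G = sets borel"
    and "measure G {0..} = 1"
    and "G \<noteq> return borel 0"
  shows "on_flat_edge G \<i> \<longleftrightarrow> measure G {Inf {x. measure G {0..x} > 0}} > 0"
proof -
  interpret fpp G
    by (rule fpp.intro[OF assms(1-3)])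
  show ?thesis
    unfolding min_weight_def[symmetric] by (rule iffI[OF atom_if_flat_edge flat_edge_if_atom])
qed

end
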